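(* For any partitions $\lambda$ and $\mu$, $$r_{\lambda\mu}=\langle S_\lambda q_\mu\rangle .$$
   Context: Let $K$ be a field of characteristic $0$ and $P=K[X_1,X_2,\dots]$. For $w\in S_n$ let $X_i(w)$ be the number of $i$-cycles of $w$. For $q\in P$ let $\langle q\rangle_n=\frac1{n!}\sum_{w\in S_n}q(X_1(w),X_2(w),\dots)$; this is constant for large $n$, and the stable moment $\langle q\rangle$ is its eventually constant value. Define $H_d\in P$ ($d\ge0$) by $\sum_{d\ge0}H_dt^d=\prod_{i\ge1}(1-t^i)^{-X_i}$ in $P[[t]]$ (binomial series), $H_d=0$ for $d<0$, and for a partition $\lambda=(\lambda_1,\dots,\lambda_l)$ put $S_\lambda=\det(H_{\lambda_i+j-i})_{1\le i,j\le l}$. It is the character polynomial of the restrictions to $S_n$ (permutation matrices) of the irreducible polynomial representations $W_\lambda(K^n)$ of $GL_n(K)$ (Weyl modules). For a partition $\mu$ and $n\ge|\mu|+\mu_1$ let $\mu[n]=(n-|\mu|,\mu_1,\mu_2,\dots)$, and let $V_{\mu[n]}$ be the Specht module of $S_n$ attached to $\mu[n]$, with character $\chi_{\mu[n]}$. Let $q_\mu\in P$ be the unique polynomial with $\chi_{\mu[n]}(w)=q_\mu(X_1(w),X_2(w),\dots)$ for all $n\ge|\mu|+\mu_1$ and $w\in S_n$ (its existence is well known). The $q_\mu$, over all partitions $\mu$, form a $K$-basis of $P$. The stable restriction coefficients $r_{\lambda\mu}$ are defined by the expansion $S_\lambda=\sum_\mu r_{\lambda\mu}q_\mu$; equivalently,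 $r_{\lambda\mu}$ is the value for all large $n$ of the multiplicity of $V_{\mu[n]}$ in the restriction of $W_\lambda(K^n)$ from $GL_n(K)$ to $S_n$. *)

theory Defs
  imports
    "HOL-Analysis.Infinite_Products"
    "HOL-Combinatorics.Orbits"
    "HOL-Library.Poly_Mapping"
    "HOL-Computational_Algebra.Formal_Power_Series"
    "Jordan_Normal_Form.Determinant"
begin

section \<open>Free vector spaces\<close>

text \<open>
  The type \<open>'a \<Rightarrow>\<^sub>0 'k\<close> of finitely supported functions is the free vector space on \<open>'a\<close>. It serves
  both as the space of polynomials (free on the monomials) and as the space spanned by tabloids.
\<close>

definition scale :: "'k::field \<Rightarrow> ('a \<Rightarrow>\<^sub>0 'k) \<Rightarrow> ('a \<Rightarrow>\<^sub>0 'k)" where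
  "scale c v = Poly_Mapping.map ((*) c) v"

lemma lookup_scale [simp]: "Poly_Mapping.lookup (scale c v) x = c * Poly_Mapping.lookup v x"
  by (simp add: scale_def Poly_Mapping.map.rep_eq when_def)

global_interpretation pm: Vector_Spaces.vector_space
  "scale :: 'k::field \<Rightarrow> ('a \<Rightarrow>\<^sub>0 'k) \<Rightarrow> ('a \<Rightarrow>\<^sub>0 'k)"
  by unfold_locales (auto intro!: poly_mapping_eqI simp: lookup_add algebra_simps)

text \<open>
  The trace of an endomorphism of a finite-dimensional subspace \<open>V\<close>; it does not depend on the
  chosen basis.
\<close>

definition trace_on :: "('a \<Rightarrow>\<^sub>0 'k::field) set \<Rightarrow> (('a \<Rightarrow>\<^sub>0 'k) \<Rightarrow> ('a \<Rightarrow>\<^sub>0 'k)) \<Rightarrow> 'k" where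
  "trace_on V f =
     (let B = (SOME B. B \<subseteq> V \<and> pm.independent B \<and> pm.span B = V)
      in \<Sum>b\<in>B. pm.representation B (f b) b)"


section \<open>Polynomials in \<open>X\<^sub>1, X\<^sub>2, \<dots>\<close> and stable moments\<close>

text \<open>
  A monomial is a finitely supported exponent vector. Since the variables are numbered from 1, index
  \<open>k\<close> of the exponent vector belongs to the variable \<open>X\<^bsub>k+1\<^esub>\<close>. The ring structure is the one
  provided by \<^theory>\<open>HOL-Library.Poly_Mapping\<close>.
\<close>

type_synonym 'k poly_inf = "(nat \<Rightarrow>\<^sub>0 nat) \<Rightarrow>\<^sub>0 'k"

definition X_var :: "nat \<Rightarrow> 'k::field_char_0 poly_inf" where
  "X_var i = Poly_Mapping.single (Poly_Mapping.single (i - 1) 1) 1"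

definition eval :: "(nat \<Rightarrow> 'k) \<Rightarrow> 'k::field_char_0 poly_inf \<Rightarrow> 'k" where
  "eval x q = (\<Sum>m\<in>Poly_Mapping.keys q.
     Poly_Mapping.lookup q m * (\<Prod>k\<in>Poly_Mapping.keys m. x (Suc k) ^ Poly_Mapping.lookup m k))"

text \<open>The symmetric group \<open>S\<^sub>n\<close> acts on \<open>{1..n}\<close>.\<close>

definition sym_group :: "nat \<Rightarrow> (nat \<Rightarrow> nat) set" where
  "sym_group n = {w. w permutes {1..n}}"

definition cycle_count :: "nat \<Rightarrow> (nat \<Rightarrow> nat) \<Rightarrow> nat \<Rightarrow> nat" where
  "cycle_count n w i = card {C \<in> orbit w ` {1..n}. card C = i}"

definition eval_perm :: "nat \<Rightarrow> 'k::field_char_0 poly_inf \<Rightarrow> (nat \<Rightarrow> nat) \<Rightarrow> 'k" where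
  "eval_perm n q w = eval (\<lambda>i. of_nat (cycle_count n w i)) q"

definition moment :: "nat \<Rightarrow> 'k::field_char_0 poly_inf \<Rightarrow> 'k" where
  "moment n q = 1 / fact n * (\<Sum>w\<in>sym_group n. eval_perm n q w)"

definition stable_moment :: "'k::field_char_0 poly_inf \<Rightarrow> 'k" where
  "stable_moment q = (THE c. \<forall>\<^sub>F n in sequentially. moment n q = c)"


section \<open>The polynomials \<open>H\<^sub>d\<close> and \<open>S\<^sub>\<lambda>\<close>\<close>

text \<open>
  Partitions are weakly decreasing lists of positive numbers. List indices start at 0, which does
  not affect the differences \<open>j - i\<close> below.
\<close>

definition is_partition :: "nat list \<Rightarrow> bool" where
  "is_partition lam \<longleftrightarrow> sorted_wrt (\<ge>) lam \<and> 0 \<notin> set lam"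

text \<open>
  The binomial series \<open>(1 + u)\<^sup>a = (\<Sum>k. (a choose k) u\<^sup>k)\<close> for a polynomial \<open>a\<close> and a power series
  \<open>u\<close> without constant term, where \<open>a choose k = a (a - 1) \<cdots> (a - k + 1) / k!\<close>.
\<close>

definition binomial_series ::
  "'k::field_char_0 poly_inf \<Rightarrow> 'k poly_inf fps \<Rightarrow> 'k poly_inf fps" where
  "binomial_series a u =
     fps_compose (Abs_fps (\<lambda>k. scale (1 / fact k) (\<Prod>j<k. a - of_nat j))) u"

text \<open>
  The product over all \<open>i \<ge> 1\<close> is taken in the topology of coefficientwise eventual constancy
  that the library provides on power series.
\<close>

definition H_series :: "'k::field_char_0 poly_inf fps" where
  "H_series = prodinf (\<lambda>i. binomial_series (- X_var (Suc i)) (- (fps_X ^ Suc i)))"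

definition H_poly :: "int \<Rightarrow> 'k::field_char_0 poly_inf" where
  "H_poly d = (if d < 0 then 0 else fps_nth H_series (nat d))"

definition S_poly :: "nat list \<Rightarrow> 'k::field_char_0 poly_inf" where
  "S_poly lam = Determinant.det (Matrix.mat (length lam) (length lam)
           (\<lambda>(i, j). H_poly (int (lam ! i) + int j - int i)))"


section \<open>Specht modules and their characters\<close>

definition cells :: "nat list \<Rightarrow> (nat \<times> nat) set" where
  "cells lam = {(i, j). i < length lam \<and> j < lam ! i}"

definition is_tableau :: "nat list \<Rightarrow> (nat \<times> nat \<Rightarrow> nat) \<Rightarrow> bool" where
  "is_tableau lam t \<longleftrightarrow> bij_betw t (cells lam) {1..sum_list lam}"

text \<open>A tabloid is represented by the list of the sets of entries of its rows.\<close>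

definition tabloid :: "nat list \<Rightarrow> (nat \<times> nat \<Rightarrow> nat) \<Rightarrow> nat set list" where
  "tabloid lam t = map (\<lambda>i. {t (i, j) | j. j < lam ! i}) [0..<length lam]"

definition column_stabilizer :: "nat list \<Rightarrow> (nat \<times> nat \<Rightarrow> nat) \<Rightarrow> (nat \<Rightarrow> nat) set" where
  "column_stabilizer lam t =
     {\<sigma> \<in> sym_group (sum_list lam).
        \<forall>j. \<sigma> ` {t (i, j) | i. (i, j) \<in> cells lam} = {t (i, j) | i. (i, j) \<in> cells lam}}"

definition polytabloid ::
  "nat list \<Rightarrow> (nat \<times> nat \<Rightarrow> nat) \<Rightarrow> (nat set list \<Rightarrow>\<^sub>0 'k::field_char_0)" where
  "polytabloid lam t =
     (\<Sum>\<sigma>\<in>column_stabilizer lam t. Poly_Mapping.single (tabloid lam (\<sigma> \<circ> t)) (of_int (sign \<sigma>)))"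

definition specht_module :: "nat list \<Rightarrow> (nat set list \<Rightarrow>\<^sub>0 'k::field_char_0) set" where
  "specht_module lam = pm.span {polytabloid lam t | t. is_tableau lam t}"

text \<open>The action of permutations on linear combinations of tabloids, extended linearly.\<close>

definition perm_action ::
  "(nat \<Rightarrow> nat) \<Rightarrow> (nat set list \<Rightarrow>\<^sub>0 'k::field_char_0) \<Rightarrow> (nat set list \<Rightarrow>\<^sub>0 'k)" where
  "perm_action w v =
     (\<Sum>T\<in>Poly_Mapping.keys v. Poly_Mapping.single (map (image w) T) (Poly_Mapping.lookup v T))"

definition specht_character :: "nat list \<Rightarrow> (nat \<Rightarrow> nat) \<Rightarrow> 'k::field_char_0" where
  "specht_character lam w = trace_on (specht_module lam) (perm_action w)"


section \<open>Character polynomials and stable restriction coefficients\<close>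

text \<open>The largest part \<open>\<mu>\<^sub>1\<close>, which is 0 for the empty partition.\<close>

definition first_part :: "nat list \<Rightarrow> nat" where
  "first_part \<mu> = (if \<mu> = [] then 0 else hd \<mu>)"

text \<open>
  The padded partition \<open>\<mu>[n] = (n - |\<mu>|, \<mu>\<^sub>1, \<mu>\<^sub>2, \<dots>)\<close>, for \<open>n \<ge> |\<mu>| + \<mu>\<^sub>1\<close>. The new part vanishes
  only for \<open>\<mu> = []\<close> and \<open>n = 0\<close>, and is then dropped.
\<close>

definition padded :: "nat list \<Rightarrow> nat \<Rightarrow> nat list" where
  "padded \<mu> n = (if n = sum_list \<mu> then \<mu> else (n - sum_list \<mu>) # \<mu>)"

text \<open>\<open>q\<close> is the character polynomial \<open>q\<^sub>\<mu>\<close>; this determines \<open>q\<close>.\<close>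

definition is_character_polynomial :: "nat list \<Rightarrow> 'k::field_char_0 poly_inf \<Rightarrow> bool" where
  "is_character_polynomial \<mu> q \<longleftrightarrow>
     (\<forall>n \<ge> sum_list \<mu> + first_part \<mu>. \<forall>w \<in> sym_group n.
        specht_character (padded \<mu> n) w = eval_perm n q w)"

text \<open>
  \<open>r\<close> is the family of coefficients of \<open>S\<^sub>\<lambda>\<close> in the basis of the polynomials \<open>q \<mu>\<close>, indexed by
  partitions \<open>\<mu>\<close>.
\<close>

definition are_restriction_coefficients ::
  "(nat list \<Rightarrow> 'k::field_char_0 poly_inf) \<Rightarrow> nat list \<Rightarrow> (nat list \<Rightarrow> 'k) \<Rightarrow> bool" where
  "are_restriction_coefficients q lam r \<longleftrightarrow>
     finite {\<mu>. is_partition \<mu> \<and> r \<mu> \<noteq> 0} \<and>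
     S_poly lam = (\<Sum>\<mu> | is_partition \<mu> \<and> r \<mu> \<noteq> 0. scale (r \<mu>) (q \<mu>))"

end

theory Submission
  imports Defs
begin

text \<open>
  Expanding \<open>S\<^sub>\<lambda>\<close> in the basis of the \<open>q\<^sub>\<nu>\<close>, the claim says that the \<open>q\<^sub>\<mu>\<close> are orthonormal for
  stable moments, that is, that the Specht characters of \<open>S\<^sub>n\<close> are orthonormal. By averaging rank one maps,
  the sum of \<open>\<chi>\<^sub>V(w\<inverse>) \<chi>\<^sub>W(w)\<close> over \<open>S\<^sub>n\<close> vanishes if there are no nonzero intertwiners from \<open>V\<close> to \<open>W\<close>,
  and equals \<open>n!\<close> if \<open>V = W \<noteq> 0\<close> and all its endomorphisms are scalar.
  Intertwiners commute with the signed sum \<open>\<kappa>\<close> over the column stabilizer of a tableau \<open>t\<close>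
  of shape \<open>\<lambda>\<close>, which multiplies the polytabloid \<open>e\<close> of \<open>t\<close> by a nonzero number. Since \<open>\<kappa>\<close> maps tabloids
  of shape \<open>\<lambda>\<close> to multiples of \<open>e\<close>, and tabloids of shape \<open>\<mu>\<close> to 0 unless \<open>\<lambda>\<close> dominates \<open>\<mu>\<close>, both conditions
  follow: dominance fails in one of the two directions if \<open>\<lambda> \<noteq> \<mu>\<close>, and the sum is symmetric in \<open>\<lambda>\<close>
  and \<open>\<mu>\<close>. Finally, \<open>\<chi>(w\<inverse>) = \<chi>(w)\<close> because \<open>w\<close> and \<open>w\<inverse>\<close> have the same cycle counts.
\<close>

unbundle no m_inv_syntax

section \<open>The action of the symmetric group\<close>

lemma finite_sym_group [simp]: "finite (sym_group n)"
  by (simp add: sym_group_def finite_permutations)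

lemma card_sym_group: "card (sym_group n) = fact n"
  by (simp add: sym_group_def card_permutations)

lemma sym_group_id [simp]: "id \<in> sym_group n"
  by (simp add: sym_group_def permutes_id)

lemma sym_group_comp: "u \<in> sym_group n \<Longrightarrow> w \<in> sym_group n \<Longrightarrow> u \<circ> w \<in> sym_group n"
  by (simp add: sym_group_def permutes_compose)

lemma sym_group_inv: "w \<in> sym_group n \<Longrightarrow> inv w \<in> sym_group n"
  by (simp add: sym_group_def permutes_inv)

lemma sym_group_bij: "w \<in> sym_group n \<Longrightarrow> bij w"
  by (auto simp: sym_group_def permutes_bij)

lemma sym_group_bij_inv: "w \<in> sym_group n \<Longrightarrow> bij (inv w)"
  by (simp add: sym_group_bij bij_imp_bij_inv)

lemma sym_group_permutation: "w \<in> sym_group n \<Longrightarrow> permutation w"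
  by (auto simp: sym_group_def intro: permutes_imp_permutation)

lemma sym_group_inv_o [simp]:
  assumes "w \<in> sym_group n"
  shows "inv w \<circ> w = id" "w \<circ> inv w = id" "inv (inv w) = w"
  using sym_group_bij[OF assms]
  by (auto simp: fun_eq_iff bij_is_inj bij_is_surj surj_f_inv_f inv_inv_eq)

lemma sum_sym_group_inv: "(\<Sum>w\<in>sym_group n. f (inv w)) = (\<Sum>w\<in>sym_group n. f w)"
  by (rule sum.reindex_bij_witness[of _ inv inv]) (auto simp: sym_group_inv)

text \<open>A bijection acts injectively on lists of sets, so exactly one tabloid is sent to
  \<open>T\<close>. With this formula the linearity and composition rules for the action can be
  checked coefficientwise.\<close>

lemma lookup_perm_action:
  assumes "bij w"
  shows "Poly_Mapping.lookup (perm_action w v) T = Poly_Mapping.lookup v (map (image (inv w)) T)"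
proof -
  have eq: "map (image w) T' = T \<longleftrightarrow> T' = map (image (inv w)) T" for T'
  proof -
    have "image (inv w) \<circ> image w = id" "image w \<circ> image (inv w) = id"
      using assms by (auto simp: fun_eq_iff image_image bij_is_inj bij_is_surj surj_f_inv_f)
    then show ?thesis
      by (metis list.map_comp list.map_id)
  qed
  have "Poly_Mapping.lookup (perm_action w v) T =
      (\<Sum>T'\<in>Poly_Mapping.keys v. Poly_Mapping.lookup v T' when T' = map (image (inv w)) T)"
    by (simp add: perm_action_def lookup_sum lookup_single eq)
  also have "\<dots> = Poly_Mapping.lookup v (map (image (inv w)) T)"
    by (auto simp: when_def in_keys_iff)
  finally show ?thesis .
qed

lemma perm_action_add: "bij w \<Longrightarrow> perm_action w (u + v) = perm_action w u + perm_action w v"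
  by (intro poly_mapping_eqI) (simp add: lookup_perm_action lookup_add)

lemma perm_action_scale: "bij w \<Longrightarrow> perm_action w (scale c v) = scale c (perm_action w v)"
  by (intro poly_mapping_eqI) (simp add: lookup_perm_action)

lemma perm_action_sum:
  "bij w \<Longrightarrow> perm_action w (sum f A) = (\<Sum>a\<in>A. perm_action w (f a))"
  by (intro poly_mapping_eqI) (simp add: lookup_perm_action lookup_sum)

lemma perm_action_zero [simp]: "perm_action w 0 = 0"
  by (simp add: perm_action_def)

lemma perm_action_single [simp]:
  "perm_action w (Poly_Mapping.single T c) = Poly_Mapping.single (map (image w) T) c"
  by (cases "c = 0") (simp_all add: perm_action_def)

lemma perm_action_id [simp]: "perm_action id v = v"
  by (intro poly_mapping_eqI) (simp add: lookup_perm_action)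

lemma perm_action_comp:
  "bij u \<Longrightarrow> bij w \<Longrightarrow> perm_action u (perm_action w v) = perm_action (u \<circ> w) v"
  by (intro poly_mapping_eqI)
    (simp add: lookup_perm_action bij_comp o_inv_distrib, simp add: o_def image_image)

section \<open>Traces and intertwiners\<close>

text \<open>Finite dimension is encoded by containment in the span of a finite set, which bounds
  every independent subset of \<open>V\<close>.\<close>

definition subrep :: "nat \<Rightarrow> (nat set list \<Rightarrow>\<^sub>0 'k::field_char_0) set \<Rightarrow> bool" where
  "subrep n V \<longleftrightarrow> pm.subspace V \<and> (\<exists>T. finite T \<and> V \<subseteq> pm.span T) \<and>
     (\<forall>w\<in>sym_group n. \<forall>v\<in>V. perm_action w v \<in> V)"

text \<open>Linearity and equivariance are demanded on \<open>V\<close> only, since \<phi> is a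
  total function whose values off \<open>V\<close> are arbitrary.\<close>

definition intertwiner :: "nat \<Rightarrow> (nat set list \<Rightarrow>\<^sub>0 'k::field_char_0) set \<Rightarrow>
    (nat set list \<Rightarrow>\<^sub>0 'k) set \<Rightarrow> ((nat set list \<Rightarrow>\<^sub>0 'k) \<Rightarrow> (nat set list \<Rightarrow>\<^sub>0 'k)) \<Rightarrow> bool" where
  "intertwiner n V W \<phi> \<longleftrightarrow> (\<forall>v\<in>V. \<phi> v \<in> W) \<and>
     (\<forall>u\<in>V. \<forall>v\<in>V. \<phi> (u + v) = \<phi> u + \<phi> v) \<and>
     (\<forall>c. \<forall>v\<in>V. \<phi> (scale c v) = scale c (\<phi> v)) \<and>
     (\<forall>w\<in>sym_group n. \<forall>v\<in>V. \<phi> (perm_action w v) = perm_action w (\<phi> v))"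

text \<open>Exposes the one basis selected by Hilbert choice in \<open>trace_on\<close>. All traces
  on \<open>V\<close> are computed in it, so independence of the basis is never invoked.\<close>

lemma trace_on_basis:
  assumes "subrep n V"
  obtains B where "finite B" "pm.independent B" "pm.span B = V" "B \<subseteq> V"
    "\<And>f. trace_on V f = (\<Sum>b\<in>B. pm.representation B (f b) b)"
proof -
  obtain T where V: "pm.subspace V" and T: "finite T" "V \<subseteq> pm.span T"
    using assms by (auto simp: subrep_def)
  define B where "B = (SOME B. B \<subseteq> V \<and> pm.independent B \<and> pm.span B = V)"
  have "\<exists>B. B \<subseteq> V \<and> pm.independent B \<and> pm.span B = V"
    by (meson V pm.maximal_independent_subset pm.span_subspace)
  then have B: "B \<subseteq> V \<and> pm.independent B \<and> pm.span B = V"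
    unfolding B_def by (rule someI_ex)
  moreover have "finite B"
    using pm.independent_span_bound[OF T(1)] B T(2) by blast
  ultimately show ?thesis
    using that[of B] by (simp add: trace_on_def B_def Let_def)
qed

text \<open>
  This is the average over \<open>S\<^sub>n\<close> of the conjugates of the rank one map sending \<open>b\<close> to \<open>c\<close> and the
  other basis vectors to 0.
\<close>

lemma intertwiner_average:
  assumes V: "subrep n V" "pm.independent B" "pm.span B = V"
    and W: "subrep n W" and c: "c \<in> W"
  shows "intertwiner n V W
    (\<lambda>v. \<Sum>w\<in>sym_group n. scale (pm.representation B (perm_action (inv w) v) b) (perm_action w c))"
    (is "intertwiner n V W ?\<phi>")
proof -
  have inV: "perm_action (inv w) v \<in> pm.span B" if "w \<in> sym_group n" "v \<in> V" for w v
    using V that sym_group_inv by (auto simp: subrep_def)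
  have "?\<phi> v \<in> W" if "v \<in> V" for v
    using W c unfolding subrep_def by (intro pm.subspace_sum pm.subspace_scale) auto
  moreover have "?\<phi> (u + v) = ?\<phi> u + ?\<phi> v" if "u \<in> V" "v \<in> V" for u v
    using V(2) inV that
    by (simp add: perm_action_add sym_group_bij_inv pm.representation_add
        pm.scale_left_distrib sum.distrib cong: sum.cong)
  moreover have "?\<phi> (scale a v) = scale a (?\<phi> v)" if "v \<in> V" for a v
    using V(2) inV that
    by (simp add: perm_action_scale sym_group_bij_inv pm.representation_scale
        pm.scale_sum_right cong: sum.cong)
  moreover have "?\<phi> (perm_action u v) = perm_action u (?\<phi> v)" if u: "u \<in> sym_group n" and v: "v \<in> V"
    for u v
  proof -
    have "?\<phi> (perm_action u v) =
        (\<Sum>w\<in>sym_group n. scale (pm.representation B (perm_action (inv w \<circ> u) v) b) (perm_action w c))"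
      using u by (simp add: perm_action_comp sym_group_bij sym_group_bij_inv cong: sum.cong)
    also have "\<dots> =
        (\<Sum>w\<in>sym_group n. scale (pm.representation B (perm_action (inv w) v) b) (perm_action (u \<circ> w) c))"
    \<comment> \<open>Substituting \<open>u \<circ> w\<close> for \<open>w\<close> moves
      \<open>u\<close> from the coefficient into the action on \<open>c\<close>.\<close>
    proof (rule sum.reindex_bij_witness[of _ "\<lambda>w. u \<circ> w" "\<lambda>w. inv u \<circ> w"])
      fix w assume w: "w \<in> sym_group n"
      show "inv u \<circ> w \<in> sym_group n" "u \<circ> w \<in> sym_group n"
        using u w by (simp_all add: sym_group_comp sym_group_inv)
      show *: "u \<circ> (inv u \<circ> w) = w" "inv u \<circ> (u \<circ> w) = w"
        using u by (simp_all add: o_assoc)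
      have "inv (inv u \<circ> w) = inv w \<circ> u"
        using u w by (simp add: o_inv_distrib sym_group_bij sym_group_bij_inv)
      then show "scale (pm.representation B (perm_action (inv (inv u \<circ> w)) v) b) (perm_action (u \<circ> (inv u \<circ> w)) c)
          = scale (pm.representation B (perm_action (inv w \<circ> u) v) b) (perm_action w c)"
        using * by simp
    qed
    also have "\<dots> = perm_action u (?\<phi> v)"
      using u by (simp add: perm_action_sum perm_action_scale perm_action_comp sym_group_bij cong: sum.cong)
    finally show ?thesis .
  qed
  ultimately show ?thesis
    unfolding intertwiner_def by blast
qed

text \<open>Multiply out the two diagonal sums. For each pair \<open>b\<close>, \<open>c\<close>,
  the sum over the group is the coefficient at \<open>c\<close> of the averaged rank one map for
  \<open>b\<close> and \<open>c\<close>, evaluated at \<open>b\<close>.\<close>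

lemma trace_pairing_average:
  assumes V: "pm.independent B" "pm.span B = V" "\<And>f. trace_on V f = (\<Sum>b\<in>B. pm.representation B (f b) b)"
    and W: "subrep n W" "pm.independent C" "pm.span C = W"
      "\<And>f. trace_on W f = (\<Sum>c\<in>C. pm.representation C (f c) c)"
  shows "(\<Sum>w\<in>sym_group n. trace_on V (perm_action (inv w)) * trace_on W (perm_action w)) =
    (\<Sum>b\<in>B. \<Sum>c\<in>C. pm.representation C (\<Sum>w\<in>sym_group n.
        scale (pm.representation B (perm_action (inv w) b) b) (perm_action w c)) c)"
proof -
  have "perm_action w c \<in> pm.span C" if "w \<in> sym_group n" "c \<in> C" for w c
    using W that by (auto simp: subrep_def pm.span_base)
  then have "pm.representation C (\<Sum>w\<in>sym_group n.
        scale (pm.representation B (perm_action (inv w) b) b) (perm_action w c)) c =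
      (\<Sum>w\<in>sym_group n. pm.representation B (perm_action (inv w) b) b * pm.representation C (perm_action w c) c)"
    if "c \<in> C" for b c
    using W(2) that by (simp add: pm.representation_sum pm.representation_scale pm.span_scale)
  then have "(\<Sum>b\<in>B. \<Sum>c\<in>C. pm.representation C (\<Sum>w\<in>sym_group n.
        scale (pm.representation B (perm_action (inv w) b) b) (perm_action w c)) c) =
      (\<Sum>b\<in>B. \<Sum>c\<in>C. \<Sum>w\<in>sym_group n.
        pm.representation B (perm_action (inv w) b) b * pm.representation C (perm_action w c) c)"
    by simp
  also have "\<dots> = (\<Sum>b\<in>B. \<Sum>w\<in>sym_group n. \<Sum>c\<in>C.
        pm.representation B (perm_action (inv w) b) b * pm.representation C (perm_action w c) c)"
    by (intro sum.cong refl sum.swap)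
  also have "\<dots> = (\<Sum>w\<in>sym_group n. \<Sum>b\<in>B. \<Sum>c\<in>C.
        pm.representation B (perm_action (inv w) b) b * pm.representation C (perm_action w c) c)"
    by (rule sum.swap)
  also have "\<dots> = (\<Sum>w\<in>sym_group n. trace_on V (perm_action (inv w)) * trace_on W (perm_action w))"
    by (simp add: V W sum_product)
  finally show ?thesis ..
qed

text \<open>Each averaged rank one map is an intertwiner, hence zero on \<open>V\<close>, so every
  summand of \<open>trace_pairing_average\<close> vanishes.\<close>

lemma trace_pairing_eq_0:
  assumes "subrep n V" "subrep n W"
    and hom: "\<And>\<phi> v. intertwiner n V W \<phi> \<Longrightarrow> v \<in> V \<Longrightarrow> \<phi> v = 0"
  shows "(\<Sum>w\<in>sym_group n. trace_on V (perm_action (inv w)) * trace_on W (perm_action w)) = 0"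
proof -
  obtain B where B: "finite B" "pm.independent B" "pm.span B = V" "B \<subseteq> V"
      "\<And>f. trace_on V f = (\<Sum>b\<in>B. pm.representation B (f b) b)"
    using trace_on_basis[OF assms(1)] by blast
  obtain C where C: "finite C" "pm.independent C" "pm.span C = W" "C \<subseteq> W"
      "\<And>f. trace_on W f = (\<Sum>b\<in>C. pm.representation C (f b) b)"
    using trace_on_basis[OF assms(2)] by blast
  have "(\<Sum>w\<in>sym_group n. scale (pm.representation B (perm_action (inv w) b) b) (perm_action w c)) = 0"
    if "b \<in> B" "c \<in> C" for b c
    using hom[OF intertwiner_average[OF assms(1) B(2,3) assms(2), of c b], of b] that B(4) C(4) by blast
  then show ?thesis
    using trace_pairing_average[OF B(2,3,5) assms(2) C(2,3,5)]
    by (simp add: pm.representation_zero)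
qed

text \<open>The averaged maps act as scalars \<open>a b c\<close>, so only \<open>b = c\<close>
  contributes to the pairing, and each \<open>a b b\<close> equals \<open>n!\<close> divided by the
  dimension. The dimension many diagonal terms add up to \<open>n!\<close>.\<close>

lemma trace_pairing_eq_fact:
  assumes V: "subrep n V" "V \<noteq> {0}"
    and hom: "\<And>\<phi>. intertwiner n V V \<phi> \<Longrightarrow> \<exists>a. \<forall>v\<in>V. \<phi> v = scale a v"
  shows "(\<Sum>w\<in>sym_group n. trace_on V (perm_action (inv w)) * trace_on V (perm_action w)) = fact n"
proof -
  obtain B where B: "finite B" "pm.independent B" "pm.span B = V" "B \<subseteq> V"
      "\<And>f. trace_on V f = (\<Sum>b\<in>B. pm.representation B (f b) b)"
    using trace_on_basis[OF V(1)] by blast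
  have "B \<noteq> {}"
    using V(2) B(3) by auto
  define \<phi> where "\<phi> b c v =
    (\<Sum>w\<in>sym_group n. scale (pm.representation B (perm_action (inv w) v) b) (perm_action w c))" for b c v
  have "\<exists>a. \<forall>v\<in>V. \<phi> b c v = scale a v" if "c \<in> B" for b c
    unfolding \<phi>_def using hom[OF intertwiner_average[OF V(1) B(2,3) V(1), of c b]] that B(4) by auto
  then have "\<forall>b c. \<exists>a. c \<in> B \<longrightarrow> (\<forall>v\<in>V. \<phi> b c v = scale a v)"
    by blast
  then obtain a where "\<forall>b c. c \<in> B \<longrightarrow> (\<forall>v\<in>V. \<phi> b c v = scale (a b c) v)"
    unfolding choice_iff by blast
  then have a: "\<phi> b c v = scale (a b c) v" if "c \<in> B" "v \<in> V" for b c v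
    using that by blast
  have rep: "pm.representation B v v = 1" if "v \<in> B" for v
    using pm.representation_basis[OF B(2) that] by simp
  \<comment> \<open>The trace of \<open>\<phi> b b\<close> is computed in two ways: as that of a
    scalar, and as a sum of \<open>n!\<close> conjugates of a rank one projection, each of trace
    1.\<close>
  have diag: "a b b * of_nat (card B) = fact n" if b: "b \<in> B" for b
  proof -
    have inB: "perm_action w v \<in> pm.span B" if "w \<in> sym_group n" "v \<in> B" for w v
      using V B that by (auto simp: subrep_def)
    have "a b b * of_nat (card B) = (\<Sum>d\<in>B. a b b * pm.representation B d d)"
      by (simp add: rep mult.commute)
    also have "\<dots> = (\<Sum>d\<in>B. pm.representation B (\<phi> b b d) d)"
      using b B a by (intro sum.cong refl) (auto simp: pm.representation_scale subset_iff)
    also have "\<dots> = (\<Sum>d\<in>B. \<Sum>w\<in>sym_group n.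
        pm.representation B (perm_action (inv w) d) b * pm.representation B (perm_action w b) d)"
      unfolding \<phi>_def using b inB B(2)
      by (simp add: pm.representation_sum pm.representation_scale pm.span_scale)
    also have "\<dots> = (\<Sum>w\<in>sym_group n. \<Sum>d\<in>B.
        pm.representation B (perm_action (inv w) d) b * pm.representation B (perm_action w b) d)"
      by (rule sum.swap)
    also have "\<dots> = (\<Sum>w\<in>sym_group n. 1)"
    proof (rule sum.cong[OF refl])
      fix w assume w: "w \<in> sym_group n"
      \<comment> \<open>Summing over \<open>d\<close> first reassembles
        \<open>perm_action w b\<close> from its coordinates; \<open>inv w\<close> then returns it to
        \<open>b\<close>.\<close>
      have "(\<Sum>d\<in>B. pm.representation B (perm_action (inv w) d) b * pm.representation B (perm_action w b) d)
          = pm.representation B (\<Sum>d\<in>B. scale (pm.representation B (perm_action w b) d) (perm_action (inv w) d)) b"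
        using inB[OF sym_group_inv[OF w]] B(2)
        by (simp add: pm.representation_sum pm.representation_scale pm.span_scale mult.commute)
      also have "(\<Sum>d\<in>B. scale (pm.representation B (perm_action w b) d) (perm_action (inv w) d)) =
          perm_action (inv w) (\<Sum>d\<in>B. scale (pm.representation B (perm_action w b) d) d)"
        using w by (simp add: perm_action_sum perm_action_scale sym_group_bij_inv)
      also have "(\<Sum>d\<in>B. scale (pm.representation B (perm_action w b) d) d) = perm_action w b"
        using inB[OF w b] B(1,2) by (simp add: pm.sum_representation_eq)
      also have "perm_action (inv w) (perm_action w b) = b"
        using w by (simp add: perm_action_comp sym_group_bij sym_group_bij_inv)
      finally show "(\<Sum>d\<in>B. pm.representation B (perm_action (inv w) d) b * pm.representation B (perm_action w b) d) = 1"
        using rep[OF b] by simp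
    qed
    also have "\<dots> = fact n"
      by (simp add: card_sym_group)
    finally show ?thesis .
  qed
  have "(\<Sum>w\<in>sym_group n. trace_on V (perm_action (inv w)) * trace_on V (perm_action w)) =
      (\<Sum>b\<in>B. \<Sum>c\<in>B. pm.representation B (\<phi> b c b) c)"
    unfolding \<phi>_def using trace_pairing_average[OF B(2,3,5) V(1) B(2,3,5)] .
  \<comment> \<open>Since \<open>\<phi> b c b\<close> is a multiple of \<open>b\<close>, its
    coefficient at any other basis vector is 0.\<close>
  also have "\<dots> = (\<Sum>b\<in>B. \<Sum>c\<in>B. if c = b then a b b else 0)"
    using a B(2,4) by (intro sum.cong refl)
      (auto simp: pm.representation_scale pm.representation_basis pm.span_base subset_iff)
  also have "\<dots> = (\<Sum>b\<in>B. a b b)"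
    using B(1) by simp
  also have "\<dots> = (\<Sum>b\<in>B. fact n / of_nat (card B))"
    using diag B(1) \<open>B \<noteq> {}\<close> by (intro sum.cong refl) (simp add: field_simps)
  also have "\<dots> = fact n"
    using B(1) \<open>B \<noteq> {}\<close> by simp
  finally show ?thesis .
qed

section \<open>Column antisymmetrizers\<close>

definition tab_column :: "nat list \<Rightarrow> (nat \<times> nat \<Rightarrow> nat) \<Rightarrow> nat \<Rightarrow> nat set" where
  "tab_column lam t j = {t (i, j) | i. (i, j) \<in> cells lam}"

lemma column_stabilizer_iff:
  "\<sigma> \<in> column_stabilizer lam t \<longleftrightarrow>
     \<sigma> \<in> sym_group (sum_list lam) \<and> (\<forall>j. \<sigma> ` tab_column lam t j = tab_column lam t j)"
  by (simp add: column_stabilizer_def tab_column_def)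

lemma column_stabilizer_sym: "\<sigma> \<in> column_stabilizer lam t \<Longrightarrow> \<sigma> \<in> sym_group (sum_list lam)"
  by (simp add: column_stabilizer_iff)

lemma finite_column_stabilizer [simp]: "finite (column_stabilizer lam t)"
  by (rule finite_subset[OF _ finite_sym_group[of "sum_list lam"]]) (auto simp: column_stabilizer_iff)

lemma comp_image: "(f \<circ> g) ` A = f ` g ` A"
  by auto

lemma column_stabilizer_comp:
  "\<sigma> \<in> column_stabilizer lam t \<Longrightarrow> \<tau> \<in> column_stabilizer lam t \<Longrightarrow> \<sigma> \<circ> \<tau> \<in> column_stabilizer lam t"
  unfolding column_stabilizer_iff comp_image by (simp add: sym_group_comp)

lemma column_stabilizer_inv:
  assumes "\<sigma> \<in> column_stabilizer lam t"
  shows "inv \<sigma> \<in> column_stabilizer lam t"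
proof -
  have \<sigma>: "\<sigma> \<in> sym_group (sum_list lam)" "\<And>j. \<sigma> ` tab_column lam t j = tab_column lam t j"
    using assms by (auto simp: column_stabilizer_iff)
  have "inv \<sigma> ` tab_column lam t j = tab_column lam t j" for j
    using \<sigma>(2)[of j] sym_group_bij[OF \<sigma>(1)] by (metis bij_is_inj image_inv_f_f)
  then show ?thesis
    using \<sigma> by (simp add: column_stabilizer_iff sym_group_inv)
qed

lemma id_in_column_stabilizer [simp]: "id \<in> column_stabilizer lam t"
  by (simp add: column_stabilizer_iff)

lemma tab_column_comp: "tab_column lam (w \<circ> t) j = w ` tab_column lam t j"
  by (auto simp: tab_column_def)

lemma map_image_tabloid: "map (image w) (tabloid lam t) = tabloid lam (w \<circ> t)"
  by (auto simp: tabloid_def)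

lemma is_tableau_comp:
  assumes "w \<in> sym_group (sum_list lam)" "is_tableau lam t"
  shows "is_tableau lam (w \<circ> t)"
  using assms bij_betw_trans permutes_imp_bij
  unfolding is_tableau_def sym_group_def by blast

text \<open>Conjugation by \<open>w\<close> carries the column stabilizer of \<open>t\<close> onto
  that of \<open>w \<circ> t\<close> and preserves signs.\<close>

lemma perm_action_polytabloid:
  assumes w: "w \<in> sym_group (sum_list lam)"
  shows "perm_action w (polytabloid lam t) = polytabloid lam (w \<circ> t)"
proof -
  have "perm_action w (polytabloid lam t) =
      (\<Sum>\<sigma>\<in>column_stabilizer lam t. Poly_Mapping.single (tabloid lam (w \<circ> \<sigma> \<circ> t)) (of_int (sign \<sigma>)))"
    using w by (simp add: polytabloid_def perm_action_sum sym_group_bij map_image_tabloid o_assoc)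
  also have "\<dots> = (\<Sum>\<tau>\<in>column_stabilizer lam (w \<circ> t).
      Poly_Mapping.single (tabloid lam (\<tau> \<circ> (w \<circ> t))) (of_int (sign \<tau>)))"
  proof (rule sum.reindex_bij_witness[of _ "\<lambda>\<tau>. inv w \<circ> \<tau> \<circ> w" "\<lambda>\<sigma>. w \<circ> \<sigma> \<circ> inv w"])
    have ww: "inv w ` w ` A = A" "w ` inv w ` A = A" for A
      using sym_group_inv_o[OF w] by (simp_all add: image_comp)
    fix \<sigma>
    have *: "inv w \<circ> (w \<circ> \<sigma> \<circ> inv w) \<circ> w = \<sigma>" "w \<circ> (inv w \<circ> \<sigma> \<circ> w) \<circ> inv w = \<sigma>"
      "(w \<circ> \<sigma> \<circ> inv w) \<circ> (w \<circ> t) = w \<circ> \<sigma> \<circ> t"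
      using sym_group_inv_o[OF w] by (metis comp_assoc comp_id id_comp)+
    show "inv w \<circ> (w \<circ> \<sigma> \<circ> inv w) \<circ> w = \<sigma>" "w \<circ> (inv w \<circ> \<sigma> \<circ> w) \<circ> inv w = \<sigma>"
      by (fact *)+
    {
      assume \<sigma>: "\<sigma> \<in> column_stabilizer lam t"
      then show "w \<circ> \<sigma> \<circ> inv w \<in> column_stabilizer lam (w \<circ> t)"
        using w unfolding column_stabilizer_iff tab_column_comp comp_image ww
        by (simp add: sym_group_comp sym_group_inv)
      have "permutation w" "permutation \<sigma>"
        using w column_stabilizer_sym[OF \<sigma>] by (auto intro: sym_group_permutation)
      then have "sign (w \<circ> \<sigma> \<circ> inv w) = sign w * sign \<sigma> * sign w"
        by (simp add: sign_compose sign_inverse permutation_compose permutation_inverse)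
      then have "sign (w \<circ> \<sigma> \<circ> inv w) = sign \<sigma>"
        by (simp add: mult.commute mult.left_commute)
      then show "Poly_Mapping.single (tabloid lam ((w \<circ> \<sigma> \<circ> inv w) \<circ> (w \<circ> t))) (of_int (sign (w \<circ> \<sigma> \<circ> inv w))) =
          Poly_Mapping.single (tabloid lam (w \<circ> \<sigma> \<circ> t)) (of_int (sign \<sigma>))"
        by (simp only: *)
    }
    assume "\<sigma> \<in> column_stabilizer lam (w \<circ> t)"
    then show "inv w \<circ> \<sigma> \<circ> w \<in> column_stabilizer lam t"
      using w unfolding column_stabilizer_iff tab_column_comp comp_image ww
      by (simp add: sym_group_comp sym_group_inv) (metis ww(1))
  qed
  finally show ?thesis
    by (simp add: polytabloid_def)
qed

text \<open>The operator \<kappa> of the group algebra. It is defined on the span of all lists of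
  sets, so that it can be applied to tabloids of a shape other than \<open>lam\<close>.\<close>

definition col_antisym ::
  "nat list \<Rightarrow> (nat \<times> nat \<Rightarrow> nat) \<Rightarrow> (nat set list \<Rightarrow>\<^sub>0 'k::field_char_0) \<Rightarrow> (nat set list \<Rightarrow>\<^sub>0 'k)" where
  "col_antisym lam t v = (\<Sum>\<sigma>\<in>column_stabilizer lam t. scale (of_int (sign \<sigma>)) (perm_action \<sigma> v))"

lemma column_stabilizer_bij: "\<sigma> \<in> column_stabilizer lam t \<Longrightarrow> bij \<sigma>"
  by (rule sym_group_bij[OF column_stabilizer_sym])

lemma col_antisym_add: "col_antisym lam t (u + v) = col_antisym lam t u + col_antisym lam t v"
  by (simp add: col_antisym_def perm_action_add column_stabilizer_bij pm.scale_right_distrib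
      sum.distrib cong: sum.cong)

lemma col_antisym_scale: "col_antisym lam t (scale c v) = scale c (col_antisym lam t v)"
  by (simp add: col_antisym_def perm_action_scale column_stabilizer_bij pm.scale_sum_right
      mult.commute cong: sum.cong)

lemma col_antisym_zero [simp]: "col_antisym lam t 0 = 0"
  by (simp add: col_antisym_def)

lemma col_antisym_sum: "col_antisym lam t (sum f A) = (\<Sum>a\<in>A. col_antisym lam t (f a))"
  by (induction A rule: infinite_finite_induct) (simp_all add: col_antisym_add)

lemma col_antisym_tabloid:
  "col_antisym lam t (Poly_Mapping.single (tabloid lam t) 1) = polytabloid lam t"
proof -
  have *: "scale a (Poly_Mapping.single T 1) = Poly_Mapping.single T a" for a :: 'a and T :: "nat set list"
    by (intro poly_mapping_eqI) (simp add: lookup_single when_def)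
  show ?thesis
    by (simp add: col_antisym_def polytabloid_def map_image_tabloid *)
qed

text \<open>Right translation by \<tau> permutes the column stabilizer and multiplies every sign by
  the sign of \<tau>.\<close>

lemma col_antisym_perm_action:
  assumes \<tau>: "\<tau> \<in> column_stabilizer lam t"
  shows "col_antisym lam t (perm_action \<tau> v) = scale (of_int (sign \<tau>)) (col_antisym lam t v)"
proof -
  have "col_antisym lam t (perm_action \<tau> v) =
      (\<Sum>\<sigma>\<in>column_stabilizer lam t. scale (of_int (sign \<sigma>)) (perm_action (\<sigma> \<circ> \<tau>) v))"
    using \<tau> by (simp add: col_antisym_def perm_action_comp column_stabilizer_bij cong: sum.cong)
  also have "\<dots> = (\<Sum>\<sigma>\<in>column_stabilizer lam t. scale (of_int (sign \<tau> * sign \<sigma>)) (perm_action \<sigma> v))"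
  proof (rule sum.reindex_bij_witness[of _ "\<lambda>\<sigma>. \<sigma> \<circ> inv \<tau>" "\<lambda>\<sigma>. \<sigma> \<circ> \<tau>"])
    fix \<sigma> assume \<sigma>: "\<sigma> \<in> column_stabilizer lam t"
    show "\<sigma> \<circ> inv \<tau> \<in> column_stabilizer lam t" "\<sigma> \<circ> \<tau> \<in> column_stabilizer lam t"
      using \<sigma> \<tau> by (simp_all add: column_stabilizer_comp column_stabilizer_inv)
    show "\<sigma> \<circ> \<tau> \<circ> inv \<tau> = \<sigma>" "\<sigma> \<circ> inv \<tau> \<circ> \<tau> = \<sigma>"
      using sym_group_inv_o[OF column_stabilizer_sym[OF \<tau>]] by (metis comp_assoc comp_id)+
    have "sign (\<sigma> \<circ> \<tau>) = sign \<sigma> * sign \<tau>"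
      using \<sigma> \<tau> by (intro sign_compose) (auto intro: sym_group_permutation column_stabilizer_sym)
    then have "sign \<tau> * sign (\<sigma> \<circ> \<tau>) = sign \<sigma>"
      by (simp add: mult.commute mult.left_commute)
    then show "scale (of_int (sign \<tau> * sign (\<sigma> \<circ> \<tau>))) (perm_action (\<sigma> \<circ> \<tau>) v)
        = scale (of_int (sign \<sigma>)) (perm_action (\<sigma> \<circ> \<tau>) v)"
      by simp
  qed
  also have "\<dots> = scale (of_int (sign \<tau>)) (col_antisym lam t v)"
    by (simp add: col_antisym_def pm.scale_sum_right)
  finally show ?thesis .
qed

text \<open>The polytabloid is a signed sum of translates of one tabloid. Each translate contributes
  its sign twice, so \<kappa> produces as many copies of the polytabloid as there are group
  elements.\<close>

lemma col_antisym_polytabloid: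
  "col_antisym lam t (polytabloid lam t) =
     scale (of_nat (card (column_stabilizer lam t))) (polytabloid lam t)"
proof -
  have "polytabloid lam t =
      (\<Sum>\<sigma>\<in>column_stabilizer lam t. scale (of_int (sign \<sigma>)) (perm_action \<sigma> (Poly_Mapping.single (tabloid lam t) 1)))"
    unfolding col_antisym_def[symmetric] by (rule col_antisym_tabloid[symmetric])
  then have "col_antisym lam t (polytabloid lam t) = (\<Sum>\<sigma>\<in>column_stabilizer lam t.
      scale (of_int (sign \<sigma>)) (col_antisym lam t (perm_action \<sigma> (Poly_Mapping.single (tabloid lam t) 1))))"
    by (metis (no_types, lifting) col_antisym_sum col_antisym_scale sum.cong)
  also have "\<dots> = (\<Sum>\<sigma>\<in>column_stabilizer lam t. polytabloid lam t)"
    by (intro sum.cong refl)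
      (simp del: perm_action_single add: col_antisym_perm_action col_antisym_tabloid flip: of_int_mult)
  finally show ?thesis
    by (simp add: pm.sum_constant_scale)
qed

text \<open>
  The transposition of \<open>x\<close> and \<open>y\<close> fixes \<open>T\<close>, but it is an odd element of the column stabilizer.
\<close>

lemma col_antisym_eq_0:
  assumes xy: "x \<noteq> y" "x \<in> tab_column lam t j" "y \<in> tab_column lam t j" and t: "is_tableau lam t"
    and T: "\<And>A. A \<in> set T \<Longrightarrow> x \<in> A \<longleftrightarrow> y \<in> A"
  shows "col_antisym lam t (Poly_Mapping.single T (1 :: 'k::field_char_0)) = 0"
proof -
  let ?\<tau> = "Transposition.transpose x y" and ?v = "Poly_Mapping.single T (1 :: 'k)"
  have inj: "inj_on t (cells lam)" and im: "t ` cells lam = {1..sum_list lam}"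
    using t by (auto simp: is_tableau_def bij_betw_def)
  \<comment> \<open>Distinct columns are disjoint because \<open>t\<close> is injective, so every
    column contains both \<open>x\<close> and \<open>y\<close> or neither.\<close>
  have "x \<in> tab_column lam t j' \<longleftrightarrow> y \<in> tab_column lam t j'" for j'
    using xy inj unfolding tab_column_def by (force dest: inj_onD)
  moreover have "x \<in> {1..sum_list lam}" "y \<in> {1..sum_list lam}"
    using xy(2,3) unfolding tab_column_def im[symmetric] by blast+
  ultimately have \<tau>: "?\<tau> \<in> column_stabilizer lam t"
    by (auto simp: column_stabilizer_iff sym_group_def permutes_swap_id)
  have "map (image ?\<tau>) T = T"
    using T by (intro map_idI) simp
  then have "col_antisym lam t ?v = scale (of_int (sign ?\<tau>)) (col_antisym lam t ?v)"
    using col_antisym_perm_action[OF \<tau>, of ?v] by simp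
  then have *: "col_antisym lam t ?v = scale (- 1) (col_antisym lam t ?v)"
    using \<open>x \<noteq> y\<close> by (simp add: sign_swap_id)
  \<comment> \<open>In characteristic 0 a vector equal to its own negative is 0.\<close>
  show ?thesis
  proof (rule poly_mapping_eqI)
    fix k
    have "Poly_Mapping.lookup (col_antisym lam t ?v) k = - Poly_Mapping.lookup (col_antisym lam t ?v) k"
      by (subst *) simp
    then show "Poly_Mapping.lookup (col_antisym lam t ?v) k = Poly_Mapping.lookup 0 k"
      by (simp add: eq_neg_iff_add_eq_0 flip: mult_2)
  qed
qed

section \<open>Dominance\<close>

text \<open>The sum of the first \<open>k\<close> parts, whose comparison for all \<open>k\<close>
  is the dominance order. Counting cells also covers \<open>k\<close> beyond the number of
  parts.\<close>

definition cells_below :: "nat list \<Rightarrow> nat \<Rightarrow> nat" where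
  "cells_below lam k = card {c \<in> cells lam. fst c < k}"

lemma cells_Sigma: "cells lam = Sigma {..<length lam} (\<lambda>i. {..<lam ! i})"
  by (auto simp: cells_def)

lemma finite_cells [simp]: "finite (cells lam)"
  by (simp add: cells_Sigma)

lemma card_cells: "card (cells lam) = sum_list lam"
  by (simp add: cells_Sigma sum_list_sum_nth atLeast0LessThan)

lemma cells_down_closed:
  assumes "is_partition lam" "(i, j) \<in> cells lam" "i' \<le> i"
  shows "(i', j) \<in> cells lam"
proof (cases "i' = i")
  case False
  then have "lam ! i \<le> lam ! i'"
    using assms by (auto simp: is_partition_def cells_def sorted_wrt_iff_nth_less)
  then show ?thesis
    using assms by (auto simp: cells_def)
qed (use assms in auto)

text \<open>Columns are initial segments, so the right side is the minimum of \<open>k\<close> and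
  the height of the column. The left side is at most the height, and at most \<open>k\<close>
  because \<open>R\<close> is injective.\<close>

lemma card_column_below:
  assumes "is_partition lam" and R: "inj_on R {i. (i, j) \<in> cells lam}"
  shows "card {i. (i, j) \<in> cells lam \<and> R i < k} \<le> card {i. (i, j) \<in> cells lam \<and> i < k}"
proof -
  let ?C = "{i. (i, j) \<in> cells lam}"
  have fin: "finite ?C"
    by (rule finite_subset[of _ "{..<length lam}"]) (auto simp: cells_def)
  show ?thesis
  proof (cases "?C \<subseteq> {..<k}")
    case True
    then show ?thesis
      using fin by (intro card_mono) auto
  next
    case False
    then obtain i where "i \<in> ?C" "i \<notin> {..<k}"
      by blast
    then have "(i, j) \<in> cells lam" "k \<le> i"
      by auto
    then have "{i. (i, j) \<in> cells lam \<and> i < k} = {..<k}"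
      using cells_down_closed[OF assms(1)] by auto
    moreover have "card {i. (i, j) \<in> cells lam \<and> R i < k} \<le> card {..<k}"
      using R by (intro card_inj_on_le[of R]) (auto simp: inj_on_def)
    ultimately show ?thesis
      by simp
  qed
qed

text \<open>The bound is the number of columns; inserting 0 makes it meaningful for the empty
  list.\<close>

lemma cells_snd_less:
  assumes "(i, j) \<in> cells lam"
  shows "j < Max (insert 0 (set lam))"
proof -
  have "j < lam ! i" "lam ! i \<in> set lam"
    using assms by (auto simp: cells_def)
  then show ?thesis
    by (intro less_le_trans[OF _ Max_ge]) auto
qed

lemma card_by_columns:
  "card {c \<in> cells lam. P c} = (\<Sum>j<Max (insert 0 (set lam)). card {i. (i, j) \<in> cells lam \<and> P (i, j)})"
    (is "_ = (\<Sum>j<?M. card (?A j))")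
proof -
  have fin: "finite (?A j)" for j
    by (rule finite_subset[of _ "{..<length lam}"]) (auto simp: cells_def)
  have "snd c < ?M" if "c \<in> cells lam" for c
    using that cells_snd_less by (cases c) auto
  then have "bij_betw (\<lambda>(j, i). (i, j)) (Sigma {..<?M} ?A) {c \<in> cells lam. P c}"
    by (intro bij_betwI[of _ _ _ "\<lambda>(i, j). (j, i)"]) fastforce+
  then have "card {c \<in> cells lam. P c} = card (Sigma {..<?M} ?A)"
    by (simp add: bij_betw_same_card)
  then show ?thesis
    using fin by simp
qed

text \<open>
  Comparing the two sides column by column turns the injectivity of \<open>f\<close> on columns into dominance.
\<close>

lemma cells_below_le:
  assumes lam: "is_partition lam" and f: "bij_betw f (cells lam) (cells mu)"
    and inj: "\<And>i i' j. (i, j) \<in> cells lam \<Longrightarrow> (i', j) \<in> cells lam \<Longrightarrow> fst (f (i, j)) = fst (f (i', j)) \<Longrightarrow> i = i'"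
  shows "cells_below mu k \<le> cells_below lam k"
    and "cells_below mu k = cells_below lam k \<Longrightarrow>
      card {i. (i, j) \<in> cells lam \<and> fst (f (i, j)) < k} = card {i. (i, j) \<in> cells lam \<and> i < k}"
proof -
  let ?M = "Max (insert 0 (set lam))"
  let ?d = "\<lambda>j. card {i. (i, j) \<in> cells lam \<and> fst (f (i, j)) < k}"
  let ?c = "\<lambda>j. card {i. (i, j) \<in> cells lam \<and> i < k}"
  have le: "?d j \<le> ?c j" for j
  proof -
    have "inj_on (\<lambda>i. fst (f (i, j))) {i. (i, j) \<in> cells lam}"
      using inj by (intro inj_onI) blast
    then show ?thesis
      by (rule card_column_below[OF lam])
  qed
  \<comment> \<open>Pulling back along \<open>f\<close> turns the count in \<open>mu\<close> into a
    count over the cells of \<open>lam\<close>, which can be split by columns.\<close>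
  have "{c \<in> cells mu. fst c < k} = f ` {c \<in> cells lam. fst (f c) < k}"
    unfolding bij_betw_imp_surj_on[OF f, symmetric] by auto
  moreover have "inj_on f {c \<in> cells lam. fst (f c) < k}"
    using f by (auto simp: bij_betw_def intro: inj_on_subset)
  ultimately have mu: "cells_below mu k = (\<Sum>j<?M. ?d j)"
    using card_by_columns[of lam "\<lambda>c. fst (f c) < k"]
    by (simp add: cells_below_def card_image)
  have lam': "cells_below lam k = (\<Sum>j<?M. ?c j)"
    using card_by_columns[of lam "\<lambda>c. fst c < k"] by (simp add: cells_below_def)
  show "cells_below mu k \<le> cells_below lam k"
    unfolding mu lam' by (intro sum_mono le)
  assume eq: "cells_below mu k = cells_below lam k"
  show "?d j = ?c j"
  proof (cases "j < ?M")
    case True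
    \<comment> \<open>Termwise inequalities with equal totals are termwise equalities.\<close>
    show ?thesis
    proof (rule ccontr)
      assume "?d j \<noteq> ?c j"
      then have "?d j < ?c j"
        using le[of j] by simp
      then have "(\<Sum>j<?M. ?d j) < (\<Sum>j<?M. ?c j)"
        using True le by (intro sum_strict_mono_ex1) auto
      then show False
        using eq mu lam' by simp
    qed
  next
    case False
    then have "(i, j) \<notin> cells lam" for i
      using cells_snd_less by blast
    then show ?thesis
      by simp
  qed
qed

text \<open>Successive differences of the partial sums recover the parts, padded by zeros. This
  gives antisymmetry of dominance.\<close>

lemma cells_below_inject:
  assumes "is_partition lam" "is_partition mu" "\<And>k. cells_below lam k = cells_below mu k"
  shows "lam = mu"
proof -
  define len where "len rho i = (if i < length rho then rho ! i else 0)" for rho :: "nat list" and i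
  have below: "cells_below rho (Suc k) = cells_below rho k + len rho k" for rho k
  proof -
    have "{c \<in> cells rho. fst c < Suc k} = {c \<in> cells rho. fst c < k} \<union> Pair k ` {..<len rho k}"
      by (auto simp: cells_def len_def less_Suc_eq)
    moreover have "{c \<in> cells rho. fst c < k} \<inter> Pair k ` {..<len rho k} = {}"
      by auto
    ultimately show ?thesis
      by (simp add: cells_below_def card_Un_disjoint card_image inj_on_def)
  qed
  have eq: "len lam k = len mu k" for k
    using below[of lam k] below[of mu k] assms(3) by simp
  \<comment> \<open>Parts of a partition are positive, so the zero padding begins exactly at its
    length.\<close>
  have pos: "k < length rho \<longleftrightarrow> len rho k \<noteq> 0" if "is_partition rho" for rho k
    using that by (auto simp: len_def is_partition_def) (metis gr0I nth_mem)
  have "k < length lam \<longleftrightarrow> k < length mu" for k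
    using pos assms(1,2) eq by simp
  then have "length lam = length mu"
    by (metis linorder_neqE_nat less_irrefl)
  then show ?thesis
  proof (rule nth_equalityI)
    fix i assume "i < length lam"
    then show "lam ! i = mu ! i"
      using eq[of i] \<open>length lam = length mu\<close> by (simp add: len_def)
  qed
qed

section \<open>Intertwiners between Specht modules\<close>

lemma tableau_in_row_iff:
  assumes "is_tableau mu s" "c \<in> cells mu" "r < length mu"
  shows "s c \<in> {s (r, j) | j. j < mu ! r} \<longleftrightarrow> fst c = r"
proof
  assume "s c \<in> {s (r, j) | j. j < mu ! r}"
  then obtain j where "s c = s (r, j)" "(r, j) \<in> cells mu"
    using assms(3) by (auto simp: cells_def)
  then have "c = (r, j)"
    using assms(1,2) by (auto simp: is_tableau_def bij_betw_def dest: inj_onD)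
  then show "fst c = r"
    by simp
next
  assume "fst c = r"
  then show "s c \<in> {s (r, j) | j. j < mu ! r}"
    using assms(2) by (cases c) (auto simp: cells_def)
qed

text \<open>The map \<open>f\<close> sends a cell of \<open>t\<close> to the cell of
  \<open>s\<close> holding the same entry. Two entries of one column of \<open>t\<close> in one row
  of \<open>s\<close> would make the antisymmetrized tabloid vanish by
  \<open>col_antisym_eq_0\<close>.\<close>

lemma column_injective_if_col_antisym_nonzero:
  assumes t: "is_tableau lam t" and s: "is_tableau mu s" and eq: "sum_list mu = sum_list lam"
    and nz: "col_antisym lam t (Poly_Mapping.single (tabloid mu s) (1 :: 'k::field_char_0)) \<noteq> 0"
  obtains f where "bij_betw f (cells lam) (cells mu)" "\<And>c. c \<in> cells lam \<Longrightarrow> s (f c) = t c"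
    "\<And>i i' j. (i, j) \<in> cells lam \<Longrightarrow> (i', j) \<in> cells lam \<Longrightarrow> fst (f (i, j)) = fst (f (i', j)) \<Longrightarrow> i = i'"
proof -
  define f where "f = inv_into (cells mu) s \<circ> t"
  have bt: "bij_betw t (cells lam) {1..sum_list lam}" and bs: "bij_betw s (cells mu) {1..sum_list lam}"
    using t s eq by (simp_all add: is_tableau_def)
  have f: "bij_betw f (cells lam) (cells mu)"
    unfolding f_def using bij_betw_trans[OF bt bij_betw_inv_into[OF bs]] .
  have sf: "s (f c) = t c" if "c \<in> cells lam" for c
    unfolding f_def using bij_betw_inv_into_right[OF bs] bij_betwE[OF bt] that by simp
  have fmu: "f c \<in> cells mu" if "c \<in> cells lam" for c
    using f that by (auto simp: bij_betw_def)
  have "i = i'" if ij: "(i, j) \<in> cells lam" "(i', j) \<in> cells lam" and row: "fst (f (i, j)) = fst (f (i', j))"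
    for i i' j
  proof (rule ccontr)
    assume "i \<noteq> i'"
    then have "t (i, j) \<noteq> t (i', j)"
      using ij bt by (auto simp: bij_betw_def dest: inj_onD)
    moreover have "t (i, j) \<in> tab_column lam t j" "t (i', j) \<in> tab_column lam t j"
      using ij by (auto simp: tab_column_def)
    moreover have "t (i, j) \<in> A \<longleftrightarrow> t (i', j) \<in> A" if "A \<in> set (tabloid mu s)" for A
    proof -
      obtain r where "r \<in> set [0..<length mu]" and A: "A = {s (r, j) | j. j < mu ! r}"
        using \<open>A \<in> set (tabloid mu s)\<close> unfolding tabloid_def set_map by blast
      then have r: "r < length mu"
        by simp
      show ?thesis
        using tableau_in_row_iff[OF s fmu[OF ij(1)] r] tableau_in_row_iff[OF s fmu[OF ij(2)] r]
        by (simp add: A row sf ij)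
    qed
    ultimately show False
      using nz col_antisym_eq_0[OF _ _ _ t] by blast
  qed
  then show ?thesis
    using that[OF f sf] by blast
qed

text \<open>Take \<open>s\<close> after the inverse of \<open>t\<close> and extend it by the
  identity.\<close>

lemma sym_group_transitive_on_tableaux:
  assumes t: "is_tableau lam t" and s: "is_tableau lam s"
  obtains w where "w \<in> sym_group (sum_list lam)" "\<And>c. c \<in> cells lam \<Longrightarrow> w (t c) = s c"
proof -
  define w where "w x = (if x \<in> {1..sum_list lam} then s (inv_into (cells lam) t x) else x)" for x
  have bt: "bij_betw t (cells lam) {1..sum_list lam}" and bs: "bij_betw s (cells lam) {1..sum_list lam}"
    using t s by (simp_all add: is_tableau_def)
  have wt: "w (t c) = s c" if "c \<in> cells lam" for c
    using that bij_betwE[OF bt] bij_betw_inv_into_left[OF bt] by (simp add: w_def)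
  have "bij_betw (s \<circ> inv_into (cells lam) t) {1..sum_list lam} {1..sum_list lam}"
    using bij_betw_trans[OF bij_betw_inv_into[OF bt] bs] .
  then have "bij_betw w {1..sum_list lam} {1..sum_list lam}"
    by (subst bij_betw_cong[of _ _ "s \<circ> inv_into (cells lam) t"]) (auto simp: w_def)
  then have "w \<in> sym_group (sum_list lam)"
    unfolding sym_group_def by (auto intro!: bij_imp_permutes simp: w_def)
  then show ?thesis
    using that wt by blast
qed

text \<open>
  The counting inequality \<open>cells_below_le\<close> is an equality here, so in every column of \<open>t\<close> each row of
  \<open>s\<close> that meets the column in the diagram is represented exactly once.
\<close>

lemma column_stabilizer_transitive:
  assumes lam: "is_partition lam" and t: "is_tableau lam t" and s: "is_tableau lam s"
    and f: "bij_betw f (cells lam) (cells lam)" "\<And>c. c \<in> cells lam \<Longrightarrow> s (f c) = t c"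
    and inj: "\<And>i i' j. (i, j) \<in> cells lam \<Longrightarrow> (i', j) \<in> cells lam \<Longrightarrow> fst (f (i, j)) = fst (f (i', j)) \<Longrightarrow> i = i'"
  obtains \<sigma> where "\<sigma> \<in> column_stabilizer lam t" "tabloid lam (\<sigma> \<circ> t) = tabloid lam s"
proof -
  let ?n = "sum_list lam"
  have bt: "bij_betw t (cells lam) {1..?n}" and bs: "bij_betw s (cells lam) {1..?n}"
    using t s by (simp_all add: is_tableau_def)
  have "\<exists>i'. (i', j) \<in> cells lam \<and> fst (f (i', j)) = i" if ij: "(i, j) \<in> cells lam" for i j
  proof -
    let ?D = "\<lambda>k. {i'. (i', j) \<in> cells lam \<and> fst (f (i', j)) < k}"
    have fin: "finite {i'. (i', j) \<in> cells lam}"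
      by (rule finite_subset[of _ "{..<length lam}"]) (auto simp: cells_def)
    have "{i'. (i', j) \<in> cells lam \<and> i' < Suc i} = insert i {i'. (i', j) \<in> cells lam \<and> i' < i}"
      using ij by (auto simp: less_Suc_eq)
    then have "card {i'. (i', j) \<in> cells lam \<and> i' < i} < card {i'. (i', j) \<in> cells lam \<and> i' < Suc i}"
      using fin by simp
    \<comment> \<open>With equal shapes the equality clause of \<open>cells_below_le\<close> applies
      at both \<open>i\<close> and \<open>Suc i\<close>. The count jumps there, so some cell of
      column \<open>j\<close> is sent to row \<open>i\<close>.\<close>
    then have "card (?D i) < card (?D (Suc i))"
      using cells_below_le(2)[OF lam f(1) inj refl] by simp
    then have "?D i \<noteq> ?D (Suc i)"
    proof (intro notI)
      assume "?D i = ?D (Suc i)"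
      with \<open>card (?D i) < card (?D (Suc i))\<close> show False
        by (simp only: less_irrefl)
    qed
    then show ?thesis
      by (auto simp: less_Suc_eq)
  qed
  then have "\<forall>i j. \<exists>i'. (i, j) \<in> cells lam \<longrightarrow> (i', j) \<in> cells lam \<and> fst (f (i', j)) = i"
    by blast
  then obtain g where g: "\<forall>i j. (i, j) \<in> cells lam \<longrightarrow> (g i j, j) \<in> cells lam \<and> fst (f (g i j, j)) = i"
    unfolding choice_iff by blast
  \<comment> \<open>Rearranges each column of \<open>t\<close>: the cell in row \<open>i\<close> and
    column \<open>j\<close> receives the entry of column \<open>j\<close> that lies in row
    \<open>i\<close> of \<open>s\<close>.\<close>
  define t' where "t' c = t (g (fst c) (snd c), snd c)" for c
  have t': "bij_betw t' (cells lam) {1..?n}"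
  proof (rule bij_betw_imageI)
    show inj': "inj_on t' (cells lam)"
    proof (rule inj_onI, clarify)
      fix i j i' j' assume c: "(i, j) \<in> cells lam" "(i', j') \<in> cells lam" and "t' (i, j) = t' (i', j')"
      then have "(g i j, j) = (g i' j', j')"
        using g bt by (auto simp: t'_def bij_betw_def dest!: inj_onD)
      \<comment> \<open>The row \<open>i\<close> is recovered as the row of
        \<open>f (g i j, j)\<close>.\<close>
      then show "i = i' \<and> j = j'"
        using g c by (metis prod.inject)
    qed
    have "t' ` cells lam \<subseteq> {1..?n}"
      using g bij_betwE[OF bt] by (fastforce simp: t'_def)
    moreover have "card (t' ` cells lam) = ?n"
      using inj' by (simp add: card_image card_cells)
    ultimately show "t' ` cells lam = {1..?n}"
      by (intro card_subset_eq) auto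
  qed
  then obtain \<sigma> where perm: "\<sigma> \<in> sym_group ?n" and \<sigma>t: "\<And>c. c \<in> cells lam \<Longrightarrow> \<sigma> (t c) = t' c"
    using sym_group_transitive_on_tableaux[OF t] by (metis is_tableau_def)
  have fin: "finite (tab_column lam t j)" for j
    by (rule finite_subset[of _ "t ` cells lam"]) (auto simp: tab_column_def)
  have "\<sigma> ` tab_column lam t j = tab_column lam t j" for j
  proof (rule card_subset_eq[OF fin])
    show "\<sigma> ` tab_column lam t j \<subseteq> tab_column lam t j"
      using g by (auto simp: tab_column_def \<sigma>t t'_def)
    show "card (\<sigma> ` tab_column lam t j) = card (tab_column lam t j)"
      using sym_group_bij[OF perm] by (intro card_image) (auto simp: bij_def intro: inj_on_subset)
  qed
  then have "\<sigma> \<in> column_stabilizer lam t"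
    using perm by (simp add: column_stabilizer_iff)
  moreover have "tabloid lam (\<sigma> \<circ> t) = tabloid lam s"
    unfolding tabloid_def
  proof (rule map_cong[OF refl])
    fix i assume "i \<in> set [0..<length lam]"
    then have i: "i < length lam"
      by simp
    have row: "{u (i, j) | j. j < lam ! i} = u ` Pair i ` {..<lam ! i}" for u :: "nat \<times> nat \<Rightarrow> nat"
      by auto
    have sub: "Pair i ` {..<lam ! i} \<subseteq> cells lam"
      using i by (auto simp: cells_def)
    \<comment> \<open>By the choice of \<open>g\<close>, row \<open>i\<close> of the rearranged
      tableau has entries from row \<open>i\<close> of \<open>s\<close> only; equal row lengths then
      give equality.\<close>
    have "{(\<sigma> \<circ> t) (i, j) | j. j < lam ! i} \<subseteq> {s (i, j) | j. j < lam ! i}"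
    proof clarify
      fix j assume "j < lam ! i"
      then have ij: "(i, j) \<in> cells lam"
        using i by (simp add: cells_def)
      have g': "(g i j, j) \<in> cells lam" "fst (f (g i j, j)) = i"
        using g ij by auto
      have "(\<sigma> \<circ> t) (i, j) = s (f (g i j, j))"
        using \<sigma>t[OF ij] f(2)[OF g'(1)] by (simp add: t'_def)
      then show "\<exists>j'. (\<sigma> \<circ> t) (i, j) = s (i, j') \<and> j' < lam ! i"
        using tableau_in_row_iff[OF s _ i, of "f (g i j, j)"] g' bij_betwE[OF f(1)] by auto
    qed
    moreover have "card {(\<sigma> \<circ> t) (i, j) | j. j < lam ! i} = card {s (i, j) | j. j < lam ! i}"
    proof -
      have "inj_on (\<sigma> \<circ> t) (cells lam)"
        using t' \<sigma>t by (auto simp: bij_betw_def inj_on_def)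
      moreover have "inj_on s (cells lam)"
        using bs by (simp add: bij_betw_def)
      ultimately show ?thesis
        unfolding row using sub by (metis card_image inj_on_subset)
    qed
    ultimately show "{(\<sigma> \<circ> t) (i, j) | j. j < lam ! i} = {s (i, j) | j. j < lam ! i}"
      by (intro card_subset_eq) auto
  qed
  ultimately show ?thesis
    using that by blast
qed

text \<open>If the result is nonzero, the tabloid of \<open>s\<close> is a translate of that of
  \<open>t\<close> by some \<sigma> in the column stabilizer, and \<kappa> sends it to the
  polytabloid of \<open>t\<close> times the sign of \<sigma>.\<close>

lemma col_antisym_tabloid_in_span:
  assumes lam: "is_partition lam" and t: "is_tableau lam t" and s: "is_tableau lam s"
  shows "col_antisym lam t (Poly_Mapping.single (tabloid lam s) 1) \<in> pm.span {polytabloid lam t}"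
proof (cases "col_antisym lam t (Poly_Mapping.single (tabloid lam s) (1 :: 'a)) = 0")
  case True
  then show ?thesis
    by (simp add: pm.span_zero)
next
  case False
  then obtain f where f: "bij_betw f (cells lam) (cells lam)" "\<And>c. c \<in> cells lam \<Longrightarrow> s (f c) = t c"
    "\<And>i i' j. (i, j) \<in> cells lam \<Longrightarrow> (i', j) \<in> cells lam \<Longrightarrow> fst (f (i, j)) = fst (f (i', j)) \<Longrightarrow> i = i'"
    using column_injective_if_col_antisym_nonzero[OF t s refl] by metis
  obtain \<sigma> where \<sigma>: "\<sigma> \<in> column_stabilizer lam t" "tabloid lam (\<sigma> \<circ> t) = tabloid lam s"
    by (rule column_stabilizer_transitive[OF lam t s f(1)]) (assumption | use f in blast)+
  have "Poly_Mapping.single (tabloid lam s) (1 :: 'a) = perm_action \<sigma> (Poly_Mapping.single (tabloid lam t) 1)"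
    by (simp add: map_image_tabloid \<sigma>(2))
  then have "col_antisym lam t (Poly_Mapping.single (tabloid lam s) (1 :: 'a)) =
      scale (of_int (sign \<sigma>)) (polytabloid lam t)"
    using col_antisym_perm_action[OF \<sigma>(1)] col_antisym_tabloid by metis
  then show ?thesis
    by (simp add: pm.span_scale pm.span_base)
qed

section \<open>Specht modules as representations inside the span of tabloids\<close>

lemma specht_module_subset:
  "specht_module lam \<subseteq> pm.span {Poly_Mapping.single (tabloid lam s) (1 :: 'k::field_char_0) | s. is_tableau lam s}"
  (is "_ \<subseteq> pm.span ?T")
proof -
  have "polytabloid lam t \<in> pm.span ?T" if t: "is_tableau lam t" for t
    unfolding col_antisym_tabloid[symmetric] col_antisym_def
  proof (intro pm.span_sum pm.span_scale)
    fix \<sigma> assume "\<sigma> \<in> column_stabilizer lam t"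
    then have "is_tableau lam (\<sigma> \<circ> t)"
      using t by (intro is_tableau_comp) (simp_all add: column_stabilizer_sym)
    then show "perm_action \<sigma> (Poly_Mapping.single (tabloid lam t) 1) \<in> pm.span ?T"
      by (intro pm.span_base) (auto simp: map_image_tabloid)
  qed
  then show ?thesis
    unfolding specht_module_def by (intro pm.span_minimal) auto
qed

lemma subrep_specht_module: "subrep (sum_list lam) (specht_module lam :: (nat set list \<Rightarrow>\<^sub>0 'k::field_char_0) set)"
proof -
  let ?S = "specht_module lam :: (nat set list \<Rightarrow>\<^sub>0 'k) set"
  let ?T = "{Poly_Mapping.single (tabloid lam s) (1 :: 'k) | s. is_tableau lam s}"
  \<comment> \<open>Finite dimension: tabloids are lists of fixed length of subsets of a finite
    set.\<close>
  have "{tabloid lam s | s. is_tableau lam s} \<subseteq> {xs. set xs \<subseteq> Pow {1..sum_list lam} \<and> length xs = length lam}"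
  proof clarify
    fix s assume "is_tableau lam s"
    then have "s c \<in> {1..sum_list lam}" if "c \<in> cells lam" for c
      using that by (auto simp: is_tableau_def bij_betw_def)
    then show "set (tabloid lam s) \<subseteq> Pow {1..sum_list lam} \<and> length (tabloid lam s) = length lam"
      by (fastforce simp: tabloid_def cells_def)
  qed
  then have "finite {tabloid lam s | s. is_tableau lam s}"
    by (rule finite_subset) (simp add: finite_lists_length_eq)
  moreover have "?T = (\<lambda>T. Poly_Mapping.single T 1) ` {tabloid lam s | s. is_tableau lam s}"
    by auto
  ultimately have "finite ?T"
    by simp
  moreover have sub: "pm.subspace ?S"
    by (simp add: specht_module_def)
  moreover have "perm_action w v \<in> ?S" if w: "w \<in> sym_group (sum_list lam)" and v: "v \<in> ?S" for w v
  proof -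
    have "?S \<subseteq> {v. perm_action w v \<in> ?S}"
      unfolding specht_module_def
    proof (rule pm.span_minimal)
      show "{polytabloid lam t | t. is_tableau lam t} \<subseteq>
          {v. perm_action w v \<in> pm.span {polytabloid lam t | t. is_tableau lam t}}"
        using w is_tableau_comp[OF w] by (auto simp: perm_action_polytabloid intro!: pm.span_base)
      show "pm.subspace {v. perm_action w v \<in> pm.span {polytabloid lam t | t. is_tableau lam t}}"
        using sym_group_bij[OF w] unfolding pm.subspace_def
        by (auto simp: perm_action_add perm_action_scale pm.span_zero intro: pm.span_add pm.span_scale)
    qed
    then show ?thesis
      using v by blast
  qed
  ultimately show ?thesis
    unfolding subrep_def using specht_module_subset by blast
qed

lemma tabloid_cong:
  assumes "\<And>c. c \<in> cells lam \<Longrightarrow> s c = t c"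
  shows "tabloid lam s = tabloid lam t"
  unfolding tabloid_def
proof (intro map_cong refl Collect_cong)
  fix i x assume "i \<in> set [0..<length lam]"
  then have "s (i, j) = t (i, j)" if "j < lam ! i" for j
    using assms that by (simp add: cells_def)
  then show "(\<exists>j. x = s (i, j) \<and> j < lam ! i) \<longleftrightarrow> (\<exists>j. x = t (i, j) \<and> j < lam ! i)"
    by metis
qed

text \<open>Serves to apply \<open>sym_group_transitive_on_tableaux\<close>, which matches two
  tableaux on the cells only.\<close>

lemma polytabloid_cong:
  assumes "\<And>c. c \<in> cells lam \<Longrightarrow> s c = t c"
  shows "polytabloid lam s = polytabloid lam t"
proof -
  have "tab_column lam s j = tab_column lam t j" for j
    unfolding tab_column_def using assms by metis
  then have "column_stabilizer lam s = column_stabilizer lam t"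
    by (auto simp: column_stabilizer_iff)
  moreover have "tabloid lam (\<sigma> \<circ> s) = tabloid lam (\<sigma> \<circ> t)" for \<sigma>
    using assms by (intro tabloid_cong) simp
  ultimately show ?thesis
    by (simp add: polytabloid_def)
qed

lemma polytabloid_in_specht_module: "is_tableau lam t \<Longrightarrow> polytabloid lam t \<in> specht_module lam"
  unfolding specht_module_def by (intro pm.span_base) auto

lemma ex_tableau: "\<exists>t. is_tableau lam t"
  unfolding is_tableau_def by (intro finite_same_card_bij) (simp_all add: card_cells)

text \<open>Such a \<sigma> keeps every entry in its column and, by equality of tabloids, in its
  row. A row and a column share at most one cell.\<close>

lemma column_stabilizer_tabloid_eq:
  assumes t: "is_tableau lam t" and \<sigma>: "\<sigma> \<in> column_stabilizer lam t"
    and eq: "tabloid lam (\<sigma> \<circ> t) = tabloid lam t"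
  shows "\<sigma> = id"
proof
  have bt: "bij_betw t (cells lam) {1..sum_list lam}"
    using t by (simp add: is_tableau_def)
  fix x
  show "\<sigma> x = id x"
  proof (cases "x \<in> {1..sum_list lam}")
    case True
    then obtain i j where ij: "(i, j) \<in> cells lam" "x = t (i, j)"
      using bt by (force simp: bij_betw_def)
    have "x \<in> tab_column lam t j"
      using ij by (auto simp: tab_column_def)
    then have "\<sigma> x \<in> tab_column lam t j"
      using \<sigma> unfolding column_stabilizer_iff by blast
    then obtain i' where i': "\<sigma> x = t (i', j)" "(i', j) \<in> cells lam"
      by (auto simp: tab_column_def)
    have i: "i < length lam" "j < lam ! i"
      using ij by (auto simp: cells_def)
    have "tabloid lam (\<sigma> \<circ> t) ! i = tabloid lam t ! i"
      using eq by simp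
    then have "{(\<sigma> \<circ> t) (i, j) | j. j < lam ! i} = {t (i, j) | j. j < lam ! i}"
      using i by (simp add: tabloid_def)
    then have "t (i', j) \<in> {t (i, j) | j. j < lam ! i}"
      using i ij i' by auto
    then show ?thesis
      using tableau_in_row_iff[OF t i'(2) i(1)] i' ij by simp
  next
    case False
    then show ?thesis
      using column_stabilizer_sym[OF \<sigma>] by (auto simp: sym_group_def permutes_def)
  qed
qed

text \<open>Only the identity contributes to the coefficient at the tabloid of \<open>t\<close>,
  which is therefore 1.\<close>

lemma polytabloid_nonzero:
  assumes t: "is_tableau lam t"
  shows "polytabloid lam t \<noteq> (0 :: nat set list \<Rightarrow>\<^sub>0 'k::field_char_0)"
proof -
  have "Poly_Mapping.lookup (polytabloid lam t :: nat set list \<Rightarrow>\<^sub>0 'k) (tabloid lam t) =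
      (\<Sum>\<sigma>\<in>column_stabilizer lam t. if \<sigma> = id then 1 else 0)"
    unfolding polytabloid_def lookup_sum
    using column_stabilizer_tabloid_eq[OF t] by (intro sum.cong) (auto simp: lookup_single when_def)
  also have "\<dots> = 1"
    by simp
  finally show ?thesis
    by auto
qed

section \<open>Schur's lemma for Specht modules\<close>

lemma intertwiner_sum:
  assumes V: "pm.subspace V" and \<phi>: "intertwiner n V W \<phi>" and f: "\<And>a. a \<in> A \<Longrightarrow> f a \<in> V"
  shows "\<phi> (sum f A) = (\<Sum>a\<in>A. \<phi> (f a))"
proof -
  \<comment> \<open>Homogeneity with scalar 0 gives the value at 0. This starts the induction and
    settles infinite index sets, whose sums are 0.\<close>
  have "\<phi> (scale 0 0) = scale 0 (\<phi> 0)"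
    using \<phi> pm.subspace_0[OF V] unfolding intertwiner_def by blast
  then have 0: "\<phi> 0 = 0"
    by simp
  show ?thesis
    using f
  proof (induction A rule: infinite_finite_induct)
    case (insert a A)
    then have "f a \<in> V" "sum f A \<in> V"
      using V by (auto intro: pm.subspace_sum)
    then show ?case
      using insert \<phi> by (simp add: intertwiner_def)
  qed (simp_all add: 0)
qed

text \<open>Since \<phi> commutes with \<kappa>, it can be applied to both sides of
  \<open>col_antisym_polytabloid\<close>. The image of the polytabloid is then determined by the
  action of \<kappa> on the target.\<close>

lemma intertwiner_polytabloid:
  fixes \<phi> :: "(nat set list \<Rightarrow>\<^sub>0 'k::field_char_0) \<Rightarrow> (nat set list \<Rightarrow>\<^sub>0 'k)"
  assumes \<phi>: "intertwiner (sum_list lam) (specht_module lam) W \<phi>" and t: "is_tableau lam t"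
  shows "scale (of_nat (card (column_stabilizer lam t))) (\<phi> (polytabloid lam t)) =
    col_antisym lam t (\<phi> (polytabloid lam t))"
proof -
  let ?e = "polytabloid lam t :: nat set list \<Rightarrow>\<^sub>0 'k"
  have V: "pm.subspace (specht_module lam :: (nat set list \<Rightarrow>\<^sub>0 'k) set)"
    by (simp add: specht_module_def)
  have e: "?e \<in> specht_module lam"
    by (rule polytabloid_in_specht_module[OF t])
  have we: "perm_action \<sigma> ?e \<in> specht_module lam" if "\<sigma> \<in> column_stabilizer lam t" for \<sigma>
    using subrep_specht_module e column_stabilizer_sym[OF that] unfolding subrep_def by blast
  have "scale (of_nat (card (column_stabilizer lam t))) (\<phi> ?e) = \<phi> (col_antisym lam t ?e)"
    using \<phi> e by (simp add: col_antisym_polytabloid intertwiner_def)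
  also have "\<dots> = (\<Sum>\<sigma>\<in>column_stabilizer lam t. \<phi> (scale (of_int (sign \<sigma>)) (perm_action \<sigma> ?e)))"
    unfolding col_antisym_def
    using we V by (intro intertwiner_sum[OF V \<phi>] pm.subspace_scale) auto
  also have "\<dots> = col_antisym lam t (\<phi> ?e)"
    unfolding col_antisym_def
    using \<phi> we e column_stabilizer_sym by (intro sum.cong) (auto simp: intertwiner_def)
  finally show ?thesis .
qed

lemma card_column_stabilizer_nonzero: "of_nat (card (column_stabilizer lam t)) \<noteq> (0 :: 'k::field_char_0)"
  using id_in_column_stabilizer[of lam t] by (auto simp del: id_in_column_stabilizer)

text \<open>Used to pass from single tabloids to their span.\<close>

lemma col_antisym_subspace:
  assumes "pm.subspace U"
  shows "pm.subspace {v. col_antisym lam t v \<in> U}"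
  using assms unfolding pm.subspace_def by (auto simp: col_antisym_add col_antisym_scale)

text \<open>A tabloid of shape \<open>mu\<close> not killed by \<kappa> yields a column-injective
  bijection of cells, hence dominance of \<open>lam\<close> over \<open>mu\<close>. Without
  dominance \<kappa> annihilates the target, so \<phi> vanishes on all polytabloids.\<close>

lemma intertwiner_specht_eq_0:
  assumes lam: "is_partition lam" and eq: "sum_list mu = sum_list lam"
    and ndom: "\<not> (\<forall>k. cells_below mu k \<le> cells_below lam k)"
    and \<phi>: "intertwiner (sum_list lam) (specht_module lam) (specht_module mu) \<phi>"
    and v: "v \<in> specht_module lam"
  shows "\<phi> v = (0 :: nat set list \<Rightarrow>\<^sub>0 'k::field_char_0)"
proof -
  let ?T = "{Poly_Mapping.single (tabloid mu s) (1 :: 'k) | s. is_tableau mu s}"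
  have *: "\<phi> (polytabloid lam t) = 0" if t: "is_tableau lam t" for t
  proof -
    have "col_antisym lam t (Poly_Mapping.single (tabloid mu s) (1 :: 'k)) = 0" if s: "is_tableau mu s" for s
      using column_injective_if_col_antisym_nonzero[OF t s eq] cells_below_le(1)[OF lam] ndom by metis
    then have "pm.span ?T \<subseteq> {v. col_antisym lam t v \<in> {0}}"
      by (intro pm.span_minimal col_antisym_subspace) auto
    moreover have "\<phi> (polytabloid lam t) \<in> pm.span ?T"
      using \<phi> polytabloid_in_specht_module[OF t] specht_module_subset unfolding intertwiner_def by blast
    ultimately have "col_antisym lam t (\<phi> (polytabloid lam t)) = 0"
      by blast
    then show ?thesis
      using intertwiner_polytabloid[OF \<phi> t] card_column_stabilizer_nonzero by simp
  qed
  have S: "specht_module lam = pm.span {polytabloid lam t | t. is_tableau lam t}"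
    by (simp add: specht_module_def)
  \<comment> \<open>The set keeps the condition of lying in the Specht module because \<phi> is
    linear only there.\<close>
  have "specht_module lam \<subseteq> {v \<in> specht_module lam. \<phi> v = 0}"
    unfolding S
  proof (rule pm.span_minimal)
    show "{polytabloid lam t | t. is_tableau lam t} \<subseteq>
        {v \<in> pm.span {polytabloid lam t | t. is_tableau lam t}. \<phi> v = 0}"
      using * by (auto intro: pm.span_base)
    have "\<phi> 0 = 0"
      using intertwiner_sum[OF _ \<phi>, of "{}"] by (simp add: specht_module_def)
    then show "pm.subspace {v \<in> pm.span {polytabloid lam t | t. is_tableau lam t}. \<phi> v = 0}"
      using \<phi> unfolding intertwiner_def S pm.subspace_def
      by (auto simp: pm.span_zero pm.span_add pm.span_scale)
  qed
  then show ?thesis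
    using v by blast
qed

text \<open>The antisymmetrizer of \<open>t\<close> maps the whole Specht module into the line of
  its polytabloid, so \<phi> scales that polytabloid. The others are translates of it, and
  equivariance gives them the same scalar. No eigenvalue is taken, so the field may be any of
  characteristic 0.\<close>

lemma intertwiner_specht_scalar:
  assumes lam: "is_partition lam"
    and \<phi>: "intertwiner (sum_list lam) (specht_module lam) (specht_module lam) \<phi>"
  shows "\<exists>a :: 'k::field_char_0. \<forall>v\<in>specht_module lam. \<phi> v = scale a v"
proof -
  let ?T = "{Poly_Mapping.single (tabloid lam s) (1 :: 'k) | s. is_tableau lam s}"
  obtain t where t: "is_tableau lam t"
    using ex_tableau by blast
  have "pm.span ?T \<subseteq> {v. col_antisym lam t v \<in> pm.span {polytabloid lam t}}"
    using col_antisym_tabloid_in_span[OF lam t] by (intro pm.span_minimal col_antisym_subspace) auto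
  moreover have "\<phi> (polytabloid lam t) \<in> pm.span ?T"
    using \<phi> polytabloid_in_specht_module[OF t] specht_module_subset unfolding intertwiner_def by blast
  ultimately have "col_antisym lam t (\<phi> (polytabloid lam t)) \<in> pm.span {polytabloid lam t}"
    by blast
  then obtain b where b: "scale (of_nat (card (column_stabilizer lam t))) (\<phi> (polytabloid lam t)) =
      scale b (polytabloid lam t)"
    unfolding intertwiner_polytabloid[OF \<phi> t, symmetric] by (auto simp: pm.span_singleton)
  \<comment> \<open>Division by the order of the column stabilizer, which is nonzero in
    characteristic 0.\<close>
  define a where "a = b / of_nat (card (column_stabilizer lam t))"
  have "scale (1 / of_nat (card (column_stabilizer lam t)))
      (scale (of_nat (card (column_stabilizer lam t))) (\<phi> (polytabloid lam t))) = scale a (polytabloid lam t)"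
    unfolding b by (simp add: a_def)
  then have a: "\<phi> (polytabloid lam t) = scale a (polytabloid lam t)"
    using card_column_stabilizer_nonzero[of lam t, where ?'k = 'k] by simp
  have e: "polytabloid lam t \<in> (specht_module lam :: (nat set list \<Rightarrow>\<^sub>0 'k) set)"
    by (rule polytabloid_in_specht_module[OF t])
  have S: "specht_module lam = pm.span {polytabloid lam t | t. is_tableau lam t}"
    by (simp add: specht_module_def)
  have "specht_module lam \<subseteq> {v \<in> specht_module lam. \<phi> v = scale a v}"
    unfolding S
  proof (rule pm.span_minimal)
    have "\<phi> (polytabloid lam s) = scale a (polytabloid lam s)" if s: "is_tableau lam s" for s
    proof -
      obtain w where w: "w \<in> sym_group (sum_list lam)" and wt: "\<And>c. c \<in> cells lam \<Longrightarrow> w (t c) = s c"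
        using sym_group_transitive_on_tableaux[OF t s] by metis
      have "polytabloid lam s = (polytabloid lam (w \<circ> t) :: nat set list \<Rightarrow>\<^sub>0 'k)"
        by (intro polytabloid_cong) (simp add: wt)
      then show ?thesis
        using \<phi> a w e
        by (simp add: intertwiner_def perm_action_scale sym_group_bij flip: perm_action_polytabloid)
    qed
    then show "{polytabloid lam t | t. is_tableau lam t} \<subseteq>
        {v \<in> pm.span {polytabloid lam t | t. is_tableau lam t}. \<phi> v = scale a v}"
      by (auto intro: pm.span_base)
    have "\<phi> 0 = 0"
      using intertwiner_sum[OF _ \<phi>, of "{}"] by (simp add: specht_module_def)
    then show "pm.subspace {v \<in> pm.span {polytabloid lam t | t. is_tableau lam t}. \<phi> v = scale a v}"
      using \<phi> unfolding intertwiner_def S pm.subspace_def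
      by (auto simp: pm.span_zero pm.span_add pm.span_scale pm.scale_right_distrib mult.commute)
  qed
  then show ?thesis
    by blast
qed

section \<open>Orthogonality of Specht characters\<close>

lemma specht_character_orthogonality:
  assumes lam: "is_partition lam" "sum_list lam = n" and mu: "is_partition mu" "sum_list mu = n"
  shows "(\<Sum>w\<in>sym_group n. specht_character lam (inv w) * specht_character mu w) =
    (if lam = mu then fact n else (0 :: 'k::field_char_0))"
proof -
  let ?S = "\<lambda>\<nu>. specht_module \<nu> :: (nat set list \<Rightarrow>\<^sub>0 'k) set"
  have sub: "subrep n (?S lam)" "subrep n (?S mu)"
    using subrep_specht_module lam(2) mu(2) by metis+
  have vanish: "(\<Sum>w\<in>sym_group n. specht_character \<kappa> (inv w) * specht_character \<nu> w) = (0 :: 'k)"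
    if "is_partition \<kappa>" "sum_list \<kappa> = n" "sum_list \<nu> = n"
      "\<not> (\<forall>k. cells_below \<nu> k \<le> cells_below \<kappa> k)" for \<kappa> \<nu>
    unfolding specht_character_def
  proof (rule trace_pairing_eq_0)
    show "subrep n (?S \<kappa>)" "subrep n (?S \<nu>)"
      using subrep_specht_module that(2,3) by metis+
    show "\<phi> v = 0" if "intertwiner n (?S \<kappa>) (?S \<nu>) \<phi>" "v \<in> ?S \<kappa>" for \<phi> v
      using intertwiner_specht_eq_0[of \<kappa> \<nu> \<phi> v] that
        \<open>is_partition \<kappa>\<close> \<open>sum_list \<kappa> = n\<close> \<open>sum_list \<nu> = n\<close>
        \<open>\<not> (\<forall>k. cells_below \<nu> k \<le> cells_below \<kappa> k)\<close> by simp
  qed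
  \<comment> \<open>Antisymmetry of dominance: for distinct partitions it fails in at least one
    direction.\<close>
  consider "lam = mu" | "lam \<noteq> mu" "\<not> (\<forall>k. cells_below mu k \<le> cells_below lam k)"
    | "lam \<noteq> mu" "\<not> (\<forall>k. cells_below lam k \<le> cells_below mu k)"
    using cells_below_inject[OF lam(1) mu(1)] by (meson antisym)
  then show ?thesis
  proof cases
    case 1
    obtain t where t: "is_tableau lam t"
      using ex_tableau by blast
    have "?S lam \<noteq> {0}"
      using polytabloid_in_specht_module[OF t] polytabloid_nonzero[OF t] by blast
    then have "(\<Sum>w\<in>sym_group n. specht_character lam (inv w) * specht_character lam w) = (fact n :: 'k)"
      unfolding specht_character_def
      using trace_pairing_eq_fact[OF sub(1)] intertwiner_specht_scalar[OF lam(1), unfolded lam(2)] by blast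
    then show ?thesis
      using 1 by simp
  next
    case 2
    then show ?thesis
      using vanish[OF lam mu(2)] by simp
  next
    case 3
    \<comment> \<open>Reindexing by inversion exchanges the two partitions and thereby reverses the
      direction of dominance.\<close>
    have "(\<Sum>w\<in>sym_group n. specht_character lam (inv w) * specht_character mu w) =
        (\<Sum>w\<in>sym_group n. specht_character mu (inv w) * (specht_character lam w :: 'k))"
      by (subst sum_sym_group_inv[symmetric]) (simp add: mult.commute cong: sum.cong)
    then show ?thesis
      using vanish[OF mu lam(2)] 3 by simp
  qed
qed

text \<open>A permutation and its inverse have the same orbits.\<close>

lemma cycle_count_inv:
  assumes "w \<in> sym_group n"
  shows "cycle_count n (inv w) i = cycle_count n w i"
  using orbit_inv_eq[OF sym_group_permutation[OF assms]] by (simp add: cycle_count_def)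

lemma eval_perm_inv: "w \<in> sym_group n \<Longrightarrow> eval_perm n q (inv w) = eval_perm n q w"
  by (simp add: eval_perm_def cycle_count_inv)

section \<open>Evaluation of polynomials and moments\<close>

definition mon_val :: "(nat \<Rightarrow> 'k::field_char_0) \<Rightarrow> (nat \<Rightarrow>\<^sub>0 nat) \<Rightarrow> 'k" where
  "mon_val x m = (\<Prod>k\<in>Poly_Mapping.keys m. x (Suc k) ^ Poly_Mapping.lookup m k)"

text \<open>Exponent 0 contributes a factor 1, so two monomials can be evaluated over a common set
  of indices.\<close>

lemma mon_val_superset:
  assumes "finite A" "Poly_Mapping.keys m \<subseteq> A"
  shows "mon_val x m = (\<Prod>k\<in>A. x (Suc k) ^ Poly_Mapping.lookup m k)"
  unfolding mon_val_def using assms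
  by (intro prod.mono_neutral_left) (auto simp: in_keys_iff)

lemma mon_val_add: "mon_val x (m + m') = mon_val x m * mon_val x m'"
proof -
  let ?A = "Poly_Mapping.keys m \<union> Poly_Mapping.keys m'"
  have "Poly_Mapping.keys (m + m') \<subseteq> ?A"
    by (rule keys_add)
  then show ?thesis
    by (simp add: mon_val_superset[of ?A] lookup_add power_add prod.distrib)
qed

lemma eval_superset:
  assumes "finite A" "Poly_Mapping.keys q \<subseteq> A"
  shows "eval x q = (\<Sum>m\<in>A. Poly_Mapping.lookup q m * mon_val x m)"
  unfolding eval_def mon_val_def using assms
  by (intro sum.mono_neutral_left) (auto simp: in_keys_iff)

lemma eval_add: "eval x (p + q) = eval x p + eval x q"
proof -
  let ?A = "Poly_Mapping.keys p \<union> Poly_Mapping.keys q"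
  have "Poly_Mapping.keys (p + q) \<subseteq> ?A"
    by (rule keys_add)
  then show ?thesis
    by (simp add: eval_superset[of ?A] lookup_add algebra_simps sum.distrib)
qed

lemma eval_zero [simp]: "eval x 0 = 0"
  by (simp add: eval_def)

lemma eval_sum: "eval x (sum f A) = (\<Sum>a\<in>A. eval x (f a))"
  by (induction A rule: infinite_finite_induct) (simp_all add: eval_add)

lemma eval_single: "eval x (Poly_Mapping.single m c) = c * mon_val x m"
  by (subst eval_superset[of "{m}"]) auto

lemma eval_scale: "eval x (scale c q) = c * eval x q"
proof -
  have "Poly_Mapping.keys (scale c q) \<subseteq> Poly_Mapping.keys q"
    by (auto simp: in_keys_iff)
  then show ?thesis
    by (simp add: eval_superset[of "Poly_Mapping.keys q"] sum_distrib_left mult.assoc)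
qed

lemma eval_mult: "eval x (p * q) = eval x p * eval x q"
proof -
  \<comment> \<open>Splitting into terms reduces multiplicativity to that of monomials.\<close>
  have dec: "r = (\<Sum>m\<in>Poly_Mapping.keys r. Poly_Mapping.single m (Poly_Mapping.lookup r m))" for r :: "'a poly_inf"
    by (intro poly_mapping_eqI) (simp add: lookup_sum lookup_single when_def in_keys_iff)
  have "p * q = (\<Sum>m\<in>Poly_Mapping.keys p. \<Sum>m'\<in>Poly_Mapping.keys q.
      Poly_Mapping.single (m + m') (Poly_Mapping.lookup p m * Poly_Mapping.lookup q m'))"
    by (subst dec[of p], subst dec[of q]) (simp add: sum_product mult_single)
  then have "eval x (p * q) = (\<Sum>m\<in>Poly_Mapping.keys p. \<Sum>m'\<in>Poly_Mapping.keys q.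
      (Poly_Mapping.lookup p m * mon_val x m) * (Poly_Mapping.lookup q m' * mon_val x m'))"
    by (simp add: eval_sum eval_single mon_val_add mult_ac)
  then show ?thesis
    by (simp add: eval_superset[of "Poly_Mapping.keys p" p] eval_superset[of "Poly_Mapping.keys q" q] sum_product)
qed

section \<open>Moments of products of character polynomials\<close>

lemma moment_scale_mult: "moment n (scale c p * q) = c * moment n (p * q)"
  by (simp add: moment_def eval_perm_def eval_mult eval_scale sum_distrib_left mult_ac)

lemma moment_sum: "moment n (sum f A) = (\<Sum>a\<in>A. moment n (f a))"
  by (simp add: moment_def eval_perm_def eval_sum sum_distrib_left sum.swap[of _ A])

text \<open>The strict bound makes the added part larger than the first part of
  \<open>\<mu>\<close>, hence positive even if \<open>\<mu>\<close> is empty.\<close>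

lemma is_partition_padded:
  assumes "is_partition \<mu>" "sum_list \<mu> + first_part \<mu> < n"
  shows "is_partition (padded \<mu> n)" "sum_list (padded \<mu> n) = n"
  using assms by (cases \<mu>; fastforce simp: is_partition_def padded_def first_part_def)+

text \<open>Values of polynomials in cycle counts are unchanged by inversion. One factor can thus be
  taken at \<open>inv w\<close>, which gives the form of
  \<open>specht_character_orthogonality\<close>.\<close>

lemma moment_mult_character_polynomials:
  fixes p q :: "'k::field_char_0 poly_inf"
  assumes \<nu>: "is_partition \<nu>" "is_character_polynomial \<nu> p" "sum_list \<nu> + first_part \<nu> < n"
    and \<mu>: "is_partition \<mu>" "is_character_polynomial \<mu> q" "sum_list \<mu> + first_part \<mu> < n"
  shows "moment n (p * q) = (if \<nu> = \<mu> then 1 else 0)"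
proof -
  have "(\<Sum>w\<in>sym_group n. eval_perm n (p * q) w) =
      (\<Sum>w\<in>sym_group n. eval_perm n p (inv w) * eval_perm n q w)"
    by (intro sum.cong refl) (simp add: eval_perm_inv, simp add: eval_perm_def eval_mult)
  also have "\<dots> = (\<Sum>w\<in>sym_group n. specht_character (padded \<nu> n) (inv w) * specht_character (padded \<mu> n) w)"
    using \<nu>(2,3) \<mu>(2,3) by (intro sum.cong refl) (simp add: is_character_polynomial_def sym_group_inv)
  also have "\<dots> = (if padded \<nu> n = padded \<mu> n then fact n else 0)"
    by (intro specht_character_orthogonality is_partition_padded \<nu>(1,3) \<mu>(1,3))
  \<comment> \<open>Both partitions have an added part here, and the tail of the list recovers the
    original.\<close>
  also have "padded \<nu> n = padded \<mu> n \<longleftrightarrow> \<nu> = \<mu>"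
    using \<nu>(3) \<mu>(3) by (auto simp: padded_def)
  finally show ?thesis
    by (simp add: moment_def)
qed

text \<open>Two eventual values agree at some common large \<open>n\<close>, so the definite
  description in \<open>stable_moment\<close> denotes \<open>c\<close>.\<close>

lemma stable_moment_eqI:
  assumes "\<forall>\<^sub>F n in sequentially. moment n q = c"
  shows "stable_moment q = c"
  unfolding stable_moment_def
proof (rule the_equality)
  show "\<forall>\<^sub>F n in sequentially. moment n q = c"
    by (fact assms)
  fix c' assume "\<forall>\<^sub>F n in sequentially. moment n q = c'"
  then have "\<forall>\<^sub>F n in sequentially. c' = c"
    using assms by eventually_elim simp
  then show "c' = c"
    by simp
qed

theorem theorem3p3:
  fixes q :: "nat list \<Rightarrow> 'k::field_char_0 poly_inf"
    and r :: "nat list \<Rightarrow> nat list \<Rightarrow> 'k"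
    and lam mu :: "nat list"
  assumes q: "\<And>\<nu>. is_partition \<nu> \<Longrightarrow> is_character_polynomial \<nu> (q \<nu>)"
    and r: "\<And>\<kappa>. is_partition \<kappa> \<Longrightarrow> are_restriction_coefficients q \<kappa> (r \<kappa>)"
    and lam: "is_partition lam"
    and mu: "is_partition mu"
  shows "r lam mu = stable_moment (S_poly lam * q mu)"
proof (rule stable_moment_eqI[symmetric])
  define N where "N = {\<nu>. is_partition \<nu> \<and> r lam \<nu> \<noteq> 0}"
  have N: "finite N" "S_poly lam = (\<Sum>\<nu>\<in>N. scale (r lam \<nu>) (q \<nu>))"
    using r[OF lam] by (simp_all add: are_restriction_coefficients_def N_def)
  have large: "\<forall>\<^sub>F n in sequentially. sum_list \<nu> + first_part \<nu> < n" for \<nu>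
    by (rule eventually_gt_at_top)
  \<comment> \<open>Finitely many coefficients are nonzero, so one threshold serves all \<nu> at
    once. This also shows that the moments of the product stabilize.\<close>
  have "\<forall>\<^sub>F n in sequentially. \<forall>\<nu>\<in>N. sum_list \<nu> + first_part \<nu> < n"
    using N(1) large by (simp add: eventually_ball_finite_distrib)
  with large[of mu] show "\<forall>\<^sub>F n in sequentially. moment n (S_poly lam * q mu) = r lam mu"
  proof eventually_elim
    case (elim n)
    have "moment n (S_poly lam * q mu) = (\<Sum>\<nu>\<in>N. r lam \<nu> * moment n (q \<nu> * q mu))"
      by (simp add: N(2) sum_distrib_right moment_sum moment_scale_mult)
    also have "\<dots> = (\<Sum>\<nu>\<in>N. if \<nu> = mu then r lam mu else 0)"
      using elim q mu by (intro sum.cong refl) (auto simp: moment_mult_character_polynomials N_def)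
    \<comment> \<open>If \<open>mu\<close> is not in \<open>N\<close>, the sum is 0, and so is the
      coefficient, because \<open>mu\<close> is a partition.\<close>
    also have "\<dots> = r lam mu"
      using N(1) mu by (auto simp: N_def)
    finally show ?case .
  qed
qed

end
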